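(* Let $\Gamma$ be a subgroup of $\mathbb{Z}^d$ of rank $k\geq 1$ which is maximal (for inclusion) among subgroups of $\mathbb{Z}^d$ of rank $k$. Let $(F_n)$ be a Følner sequence for $\Gamma$. Let $Y_n$ denote a uniform element of $F_n$. Then $\mu_{F_n,\mathsf{gcd}_\infty}$ converges to $\mu^{\Gamma}_{\infty,\mathsf{gcd}_\infty}$ on $\mathbb{Z}^d\setminus\Gamma$. If furthermore $k=1$ or the sequence of $\mathbb{N}$-valued random variables $\gcd(Y_n)$ is tight, then $\mu_{F_n,\mathsf{gcd}_\infty}$ converges weakly to $\mu^{\Gamma}_{\infty,\mathsf{gcd}_\infty}$.
   Context: $\mathbb{N}=\{0,1,2,\dots\}$ and $\overline{\mathbb{N}}:=\mathbb{N}\cup\{\infty\}$ with its usual topology (one-point compactification of the discrete space $\mathbb{N}$). $\Omega_{\overline{\mathbb{N}}}:=\overline{\mathbb{N}}^{\mathbb{Z}^d}$ with the product topology; probability measures carry the weak topology. For $x\in\mathbb{Z}^d$, $\gcd(x):=\gcd(x_1,\dots,x_d)$, with $\gcd(0,\dots,0)=0$; $\mathsf{gcd}_\infty\in\Omega_{\overline{\mathbb{N}}}$ is the map $x\mapsto\gcd(x)$. For a nonempty finite $F\subset\mathbb{Z}^d$, $\mu_{F,\mathsf{gcd}_\infty}$ is the distribution of the random element $x\mapsto\gcd(x+Y)$ of $\Omega_{\overline{\mathbb{N}}}$, where $Y$ is uniform in $F$. For $V\subset\mathbb{Z}^d$, with $\pi:\overline{\mathbb{N}}^{\mathbb{Z}^d}\to\overline{\mathbb{N}}^{V}$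 the projection, a sequence $\mu_n$ of probability measures on $\Omega_{\overline{\mathbb{N}}}$ converges to $\mu_\infty$ on $V$ if the pushforwards $\pi_\sharp\mu_n$ converge weakly to $\pi_\sharp\mu_\infty$. A sequence $(F_n)$ of nonempty finite subsets of $\Gamma$ is a Følner sequence for $\Gamma$ if for every $y\in\Gamma$, $|F_n\Delta(F_n+y)|=o(|F_n|)$. Definition of $\mu^{\Gamma}_{\infty,\mathsf{gcd}_\infty}$: independently for every prime $p$, set $\mathcal{W}_0^p:=\mathbb{Z}^d$ and, for each $n\ge1$, conditionally on $(\mathcal{W}_0^p,\dots,\mathcal{W}_{n-1}^p)$, pick $\mathcal{W}_n^p$ uniformly among the cosets of $p^n\mathbb{Z}^d$ lying inside $\mathcal{W}_{n-1}^p$ and intersecting $\Gamma$. (This corresponds to taking a Haar distributed element in the closure of $\Gamma$ in $\hat{\mathbb{Z}}^d$.) Let $V_p(x):=\sup\{n\in\mathbb{N} : x\in\mathcal{W}_n^p\}\in\overline{\mathbb{N}}$. Then $\mu^{\Gamma}_{\infty,\mathsf{gcd}_\infty}$ is the distribution on $\Omega_{\overline{\mathbb{N}}}$ of the random map $x\mapsto\prod_{p\text{ prime}}p^{V_p(x)}$ (with the convention that the product is $0$ if $V_p(x)=\infty$ for all $p$). *)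

theory Defs
  imports "HOL-Probability.Probability" "HOL-Library.Landau_Symbols"
begin

section \<open>Subgroups of \<open>\<int>\<^sup>d\<close> and their rank\<close>

interpretation zvec: module "(*s) :: int \<Rightarrow> int ^ 'd \<Rightarrow> int ^ 'd"
  by standard (simp_all add: vec_eq_iff algebra_simps)

definition add_subgroup :: "(int ^ 'd) set \<Rightarrow> bool" where
  "add_subgroup \<Gamma> \<longleftrightarrow> 0 \<in> \<Gamma> \<and> (\<forall>x\<in>\<Gamma>. \<forall>y\<in>\<Gamma>. x + y \<in> \<Gamma>) \<and> (\<forall>x\<in>\<Gamma>. - x \<in> \<Gamma>)"

text \<open>The rank is the largest number of \<open>\<int>\<close>-linearly independent elements; the cardinalities
  below are bounded by \<open>d\<close>, so the maximum exists.\<close>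

definition zrank :: "(int ^ 'd) set \<Rightarrow> nat" where
  "zrank \<Gamma> = Max {card B | B. finite B \<and> B \<subseteq> \<Gamma> \<and> zvec.independent B}"

definition maximal_of_rank :: "nat \<Rightarrow> (int ^ 'd) set \<Rightarrow> bool" where
  "maximal_of_rank k \<Gamma> \<longleftrightarrow> add_subgroup \<Gamma> \<and> zrank \<Gamma> = k \<and>
     (\<forall>\<Delta>. add_subgroup \<Delta> \<and> zrank \<Delta> = k \<and> \<Gamma> \<subseteq> \<Delta> \<longrightarrow> \<Delta> = \<Gamma>)"

definition Folner_sequence :: "(int ^ 'd) set \<Rightarrow> (nat \<Rightarrow> (int ^ 'd) set) \<Rightarrow> bool" where
  "Folner_sequence \<Gamma> F \<longleftrightarrow>
     (\<forall>n. finite (F n) \<and> F n \<noteq> {} \<and> F n \<subseteq> \<Gamma>) \<and>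
     (\<forall>y\<in>\<Gamma>. (\<lambda>n. real (card (sym_diff (F n) ((\<lambda>x. x + y) ` F n)))) \<in> o(\<lambda>n. real (card (F n))))"

section \<open>Weak convergence\<close>

text \<open>The order topology of \<^typ>\<open>enat\<close> is the one-point compactification of the discrete space
  \<open>\<nat>\<close>, and function types carry the product topology, so that \<open>int ^ 'd \<Rightarrow> enat\<close> with its
  \<^const>\<open>borel\<close> measurable structure is the configuration space.\<close>

definition borel_of :: "'a topology \<Rightarrow> 'a measure" where
  "borel_of T = sigma (topspace T) {U. openin T U}"

definition weakly_converges :: "'a topology \<Rightarrow> (nat \<Rightarrow> 'a measure) \<Rightarrow> 'a measure \<Rightarrow> bool" where
  "weakly_converges T \<mu> \<nu> \<longleftrightarrow>
     (\<forall>f. continuous_map T euclideanreal f \<and> bounded (f ` topspace T) \<longrightarrow>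
        (\<lambda>n. \<integral>\<omega>. f \<omega> \<partial>\<mu> n) \<longlonglongrightarrow> (\<integral>\<omega>. f \<omega> \<partial>\<nu>))"

definition pushforward_on :: "'i set \<Rightarrow> ('i \<Rightarrow> enat) measure \<Rightarrow> ('i \<Rightarrow> enat) measure" where
  "pushforward_on V \<mu> =
     distr \<mu> (borel_of (product_topology (\<lambda>_. euclidean) V)) (\<lambda>\<omega>. restrict \<omega> V)"

definition converges_on ::
    "'i set \<Rightarrow> (nat \<Rightarrow> ('i \<Rightarrow> enat) measure) \<Rightarrow> ('i \<Rightarrow> enat) measure \<Rightarrow> bool" where
  "converges_on V \<mu> \<nu> \<longleftrightarrow>
     weakly_converges (product_topology (\<lambda>_. euclidean) V)
       (\<lambda>n. pushforward_on V (\<mu> n)) (pushforward_on V \<nu>)"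

section \<open>The gcd seen from a uniform point of a finite set\<close>

definition vgcd :: "int ^ 'd \<Rightarrow> nat" where
  "vgcd x = nat (GCD i\<in>UNIV. x $ i)"

definition gcd_inf :: "int ^ 'd \<Rightarrow> enat" where
  "gcd_inf x = enat (vgcd x)"

definition shift_law ::
    "(int ^ 'd) set \<Rightarrow> (int ^ 'd \<Rightarrow> enat) \<Rightarrow> (int ^ 'd \<Rightarrow> enat) measure" where
  "shift_law F g = distr (measure_pmf (pmf_of_set F)) borel (\<lambda>y x. g (x + y))"

section \<open>The limit law\<close>

definition cosets_of :: "nat \<Rightarrow> (int ^ 'd) set set" where
  "cosets_of m = range (\<lambda>a. range (\<lambda>z. a + int m *s z))"

text \<open>Transition kernels of the chain \<open>\<W>\<^sub>0, \<W>\<^sub>1, \<dots>\<close>: the argument \<open>w\<close> is the history up to time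
  \<open>n - 1\<close>. The set of candidate cosets is finite and nonempty for every history of positive
  probability. For the other histories \<^const>\<open>pmf_of_set\<close> is an arbitrary distribution,
  which does not affect the law of the chain.\<close>

definition coset_kernel ::
    "(int ^ 'd) set \<Rightarrow> nat \<Rightarrow> nat \<Rightarrow> (nat \<Rightarrow> (int ^ 'd) set) \<Rightarrow> (int ^ 'd) set measure" where
  "coset_kernel \<Gamma> p n w =
     (if n = 0 then measure_pmf (return_pmf UNIV)
      else measure_pmf (pmf_of_set {C \<in> cosets_of (p ^ n). C \<subseteq> w (n - 1) \<and> C \<inter> \<Gamma> \<noteq> {}}))"

interpretation coset: Ionescu_Tulcea "coset_kernel \<Gamma> p" "\<lambda>_. count_space UNIV"
  for \<Gamma> :: "(int ^ 'd) set" and p :: nat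
proof (rule Ionescu_Tulcea.intro)
  fix n :: nat
  show "coset_kernel \<Gamma> p n \<in>
      measurable (PiM {0..<n} (\<lambda>_. count_space UNIV)) (subprob_algebra (count_space UNIV))"
  proof (cases "n = 0")
    case True
    then show ?thesis
      by (auto simp: coset_kernel_def[abs_def] space_subprob_algebra
          intro!: measurable_const prob_space_imp_subprob_space measure_pmf.prob_space_axioms)
  next
    case False
    define h :: "(int ^ 'd) set \<Rightarrow> (int ^ 'd) set measure" where
      "h W = measure_pmf (pmf_of_set {C \<in> cosets_of (p ^ n). C \<subseteq> W \<and> C \<inter> \<Gamma> \<noteq> {}})" for W
    have "h \<in> measurable (count_space UNIV) (subprob_algebra (count_space UNIV))"
      by (auto simp: h_def space_subprob_algebra
          intro!: prob_space_imp_subprob_space measure_pmf.prob_space_axioms)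
    moreover have "(\<lambda>w. w (n - 1)) \<in> measurable
        (PiM {0..<n} (\<lambda>_. count_space UNIV :: (int ^ 'd) set measure)) (count_space UNIV)"
      using False by (intro measurable_component_singleton) auto
    ultimately have "(\<lambda>w. h (w (n - 1))) \<in>
        measurable (PiM {0..<n} (\<lambda>_. count_space UNIV)) (subprob_algebra (count_space UNIV))"
      by (rule measurable_compose[rotated])
    with False show ?thesis
      by (simp add: coset_kernel_def[abs_def] h_def)
  qed
next
  fix n :: nat and w :: "nat \<Rightarrow> (int ^ 'd) set"
  show "prob_space (coset_kernel \<Gamma> p n w)"
    by (auto simp: coset_kernel_def intro: measure_pmf.prob_space_axioms)
qed

text \<open>The law of \<open>(\<W>\<^sub>n)\<close> for one prime, by the Ionescu-Tulcea theorem.\<close>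

definition coset_chain_law :: "(int ^ 'd) set \<Rightarrow> nat \<Rightarrow> (nat \<Rightarrow> (int ^ 'd) set) measure" where
  "coset_chain_law \<Gamma> p = coset.PF.lim \<Gamma> p"

definition valuation :: "(nat \<Rightarrow> (int ^ 'd) set) \<Rightarrow> int ^ 'd \<Rightarrow> enat" where
  "valuation W x = (SUP n\<in>{n. x \<in> W n}. enat n)"

definition enat_pow :: "nat \<Rightarrow> enat \<Rightarrow> enat" where
  "enat_pow p v = (case v of enat n \<Rightarrow> enat (p ^ n) | \<infinity> \<Rightarrow> \<infinity>)"

text \<open>The infinite product is the supremum of its finite subproducts, all factors being \<open>\<ge> 1\<close>.\<close>

definition prime_product :: "(nat \<Rightarrow> enat) \<Rightarrow> enat" where
  "prime_product v =
     (if \<forall>p. prime p \<longrightarrow> v p = \<infinity> then 0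
      else (SUP P\<in>{P. finite P \<and> (\<forall>p\<in>P. prime p)}. \<Prod>p\<in>P. enat_pow p (v p)))"

definition limit_law :: "(int ^ 'd) set \<Rightarrow> (int ^ 'd \<Rightarrow> enat) measure" where
  "limit_law \<Gamma> =
     distr (PiM {p. prime p} (coset_chain_law \<Gamma>)) borel
       (\<lambda>W x. prime_product (\<lambda>p. valuation (W p) x))"

end

theory Submission
  imports Defs "HOL-Number_Theory.Totient" "HOL-Number_Theory.Cong"
begin

text \<open>
  Truncate all gcds: keep only the primes \<open>p \<le> M\<close>, and only the first \<open>M\<close> powers of each. The
  truncated gcd of \<open>x + y\<close> depends on \<open>y\<close> only through its residues modulo \<open>p ^ M\<close> for \<open>p \<le> M\<close>.
  A Foelner sequence equidistributes in every finite quotient of \<open>\<Gamma>\<close>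
  (\<open>Folner_equidistributed\<close>). By the Chinese remainder theorem (\<open>neg_class_tuples\<close>) the relevant
  quotient is the product over \<open>p \<le> M\<close> of the images of \<open>\<Gamma>\<close> modulo \<open>p ^ M\<close>, and the uniform law on
  this product is the joint law of the cosets \<open>\<W>\<^sub>M\<close> of the independent chains
  (\<open>chain_marginal\<close>). Hence for fixed \<open>M\<close> the truncated gcds seen from a uniform point of
  \<open>F n\<close> converge, as \<open>n\<close> grows, to the truncation of the limit configuration, when tested
  against any bounded measurable function (\<open>truncated_gcd_limit\<close>).

  It remains to let \<open>M\<close> tend to infinity on both sides. On the limit side the truncations
  increase almost surely to the limit configuration, so dominated convergence applies
  (\<open>truncated_config_tendsto\<close>). The convention that the product is \<open>0\<close> when all valuations are
  infinite is harmless: a subgroup of positive rank has unboundedly many residue classes modulo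
  \<open>2 ^ n\<close>, so no point stays in the chain of the prime \<open>2\<close> for ever (\<open>AE_chains_escape\<close>).
  On the side of \<open>F n\<close> the truncation error at each point \<open>x\<close> must be small uniformly in large
  \<open>n\<close>. By compactness a continuous function of the configuration nearly depends on finitely many
  coordinates, each known only up to a threshold \<open>K\<close> above which all values are identified
  (\<open>continuous_map_finite_dependence\<close>), so such pointwise control suffices
  (\<open>convergence_criterion\<close>). There are three reasons for it.

  \<^item> If \<open>x \<notin> \<Gamma>\<close>, maximality makes \<open>\<Gamma>\<close> saturated, so some integral linear form vanishes on \<open>\<Gamma>\<close> but
    not at \<open>x\<close>. Its value at \<open>x\<close> is divisible by \<open>gcd (x + y)\<close> for every \<open>y \<in> \<Gamma>\<close>, and the truncation
    is exact as soon as \<open>M\<close> exceeds this value.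
  \<^item> If \<open>x \<in> \<Gamma>\<close> and the gcds are tight, the Foelner property transfers tightness from \<open>gcd (Y\<^sub>n)\<close> to
    \<open>gcd (x + Y\<^sub>n)\<close>, and the truncation is exact for positive gcds up to \<open>M\<close>.
  \<^item> If \<open>x \<in> \<Gamma>\<close> and \<open>\<Gamma>\<close> has rank one, then \<open>\<Gamma>\<close> is cyclic, and a prime \<open>p\<close> divides \<open>gcd (x + Y\<^sub>n)\<close>
    with limiting probability at least \<open>1 / p\<close>, asymptotically independently for different primes. As
    \<open>\<Prod>p\<le>M. 1 - 1 / p\<close> tends to \<open>0\<close>, some prime \<open>p \<ge> K\<close> with \<open>p \<le> M\<close> divides the gcd with high
    probability, and then the gcd and its truncation both lie above the threshold \<open>K\<close>.
\<close>

section \<open>Residue classes in subgroups of \<open>\<int>\<^sup>d\<close>\<close>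

lemma dvd_vgcd_iff: "m dvd vgcd x \<longleftrightarrow> (\<forall>i. int m dvd x $ i)"
proof -
  have "m dvd vgcd x \<longleftrightarrow> int m dvd (GCD i\<in>UNIV. x $ i)"
    unfolding vgcd_def by (metis Gcd_int_greater_eq_0 int_dvd_int_iff nat_0_le)
  then show ?thesis by (simp add: dvd_Gcd_iff)
qed

lemma vgcd_eq_0_iff: "vgcd x = 0 \<longleftrightarrow> x = 0"
  using dvd_vgcd_iff[of 0 x] by (simp add: vec_eq_iff)

lemma dvd_vgcd_uminus: "m dvd vgcd (- x) \<longleftrightarrow> m dvd vgcd x"
  by (simp add: dvd_vgcd_iff)

lemma dvd_vgcd_add: "m dvd vgcd x \<Longrightarrow> m dvd vgcd y \<Longrightarrow> m dvd vgcd (x + y)"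
  by (simp add: dvd_vgcd_iff)

lemma dvd_vgcd_diff: "m dvd vgcd x \<Longrightarrow> m dvd vgcd y \<Longrightarrow> m dvd vgcd (x - y)"
  by (simp add: dvd_vgcd_iff)

lemma add_subgroup_scale:
  assumes "add_subgroup \<Gamma>" "x \<in> \<Gamma>" shows "a *s x \<in> \<Gamma>"
proof -
  have nat: "int n *s x \<in> \<Gamma>" for n
  proof (induction n)
    case 0
    have "(0::int) *s x = 0" by (simp add: vec_eq_iff)
    then show ?case using assms by (simp add: add_subgroup_def)
  next
    case (Suc n)
    have "int (Suc n) *s x = int n *s x + x" by (simp add: vec_eq_iff algebra_simps)
    then show ?case using Suc assms by (auto simp: add_subgroup_def)
  qed
  show ?thesis
  proof (cases "a \<ge> 0")
    case True
    then show ?thesis using nat[of "nat a"] by simp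
  next
    case False
    then have "a *s x = - (int (nat (- a)) *s x)" by (simp add: vec_eq_iff)
    then show ?thesis using nat[of "nat (- a)"] assms by (simp add: add_subgroup_def)
  qed
qed

lemma add_subgroup_sum:
  assumes "add_subgroup \<Gamma>" "\<And>i. i \<in> I \<Longrightarrow> f i \<in> \<Gamma>" shows "sum f I \<in> \<Gamma>"
  using assms(2)
proof (induction I rule: infinite_finite_induct)
  case (insert i I)
  then show ?case using assms(1) by (auto simp: add_subgroup_def)
qed (use assms(1) in \<open>auto simp: add_subgroup_def\<close>)

lemma add_subgroup_diff:
  assumes "add_subgroup \<Gamma>" "x \<in> \<Gamma>" "y \<in> \<Gamma>" shows "x - y \<in> \<Gamma>"
  using assms by (metis add_subgroup_def diff_conv_add_uminus)

text \<open>
  The coset of \<open>- y\<close> modulo \<open>m\<close>. With this sign \<open>x\<close> lies in the class exactly when \<open>m\<close> divides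
  \<open>x + y\<close>, which is how the classes enter the gcd of a translate.
\<close>

definition neg_class :: "nat \<Rightarrow> int ^ 'd \<Rightarrow> (int ^ 'd) set" where
  "neg_class m y = {z. m dvd vgcd (z + y)}"

lemma neg_class_eq_iff: "neg_class m y = neg_class m y' \<longleftrightarrow> m dvd vgcd (y - y')"
proof
  assume "neg_class m y = neg_class m y'"
  moreover have "- y' \<in> neg_class m y'" by (simp add: neg_class_def dvd_vgcd_iff)
  ultimately have "- y' \<in> neg_class m y" by simp
  then have "m dvd vgcd (- y' + y)" by (simp add: neg_class_def)
  then show "m dvd vgcd (y - y')" by (simp add: add.commute)
next
  assume *: "m dvd vgcd (y - y')"
  have "m dvd vgcd (z + y) \<longleftrightarrow> m dvd vgcd (z + y')" for z
    using dvd_vgcd_add[OF *, of "z + y'"] dvd_vgcd_diff[OF _ *, of "z + y"] by (auto simp: algebra_simps)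
  then show "neg_class m y = neg_class m y'" by (simp add: neg_class_def)
qed

lemma coset_eq_neg_class: "range (\<lambda>z. a + int m *s z) = neg_class m (- a)"
proof (intro set_eqI iffI)
  fix w assume "w \<in> neg_class m (- a)"
  then have "\<forall>i. int m dvd w $ i - a $ i" by (simp add: neg_class_def dvd_vgcd_iff)
  then have "\<forall>i. \<exists>c. w $ i - a $ i = int m * c" by (auto elim: dvdE)
  then obtain c where c: "\<And>i. w $ i - a $ i = int m * c i" by metis
  have "w = a + int m *s (\<chi> i. c i)" 
    using c by (simp add: vec_eq_iff) (metis diff_add_cancel add.commute)
  then show "w \<in> range (\<lambda>z. a + int m *s z)" by blast
qed (auto simp: neg_class_def dvd_vgcd_iff)

lemma cosets_meeting_eq:
  assumes "add_subgroup \<Gamma>"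
  shows "{C \<in> cosets_of m. C \<inter> \<Gamma> \<noteq> {}} = neg_class m ` \<Gamma>"
proof (intro set_eqI iffI)
  fix C assume "C \<in> {C \<in> cosets_of m. C \<inter> \<Gamma> \<noteq> {}}"
  then obtain a z where a: "C = neg_class m (- a)" "z \<in> C" "z \<in> \<Gamma>"
    by (auto simp: cosets_of_def coset_eq_neg_class)
  then have "C = neg_class m (- z)"
    by (simp add: neg_class_eq_iff) (simp add: neg_class_def)
  then show "C \<in> neg_class m ` \<Gamma>" using a(3) assms by (auto simp: add_subgroup_def)
next
  fix C assume "C \<in> neg_class m ` \<Gamma>"
  then obtain y where y: "y \<in> \<Gamma>" "C = neg_class m y" by auto
  have "C = range (\<lambda>z. - y + int m *s z)" unfolding coset_eq_neg_class using y by simp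
  moreover have "- y \<in> C \<inter> \<Gamma>" using y assms by (auto simp: add_subgroup_def neg_class_def dvd_vgcd_iff)
  ultimately show "C \<in> {C \<in> cosets_of m. C \<inter> \<Gamma> \<noteq> {}}" unfolding cosets_of_def by blast
qed

text \<open>Each class has a representative with all coordinates in \<open>{0..<m}\<close>.\<close>

lemma finite_neg_class_image:
  fixes S :: "(int ^ 'd) set" assumes "m > 0" shows "finite (neg_class m ` S)"
proof (rule finite_subset)
  let ?B = "(\<lambda>f. neg_class m (\<chi> i. f i)) ` (UNIV \<rightarrow>\<^sub>E {0..<int m})"
  show "neg_class m ` S \<subseteq> ?B"
  proof safe
    fix y :: "int ^ 'd"
    have "neg_class m y = neg_class m (\<chi> i. y $ i mod int m)"
      by (simp add: neg_class_eq_iff dvd_vgcd_iff) 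
    then show "neg_class m y \<in> ?B"
      using assms by (intro image_eqI[of _ _ "\<lambda>i. y $ i mod int m"]) auto
  qed
  show "finite ?B" by (intro finite_imageI finite_PiE) auto
qed

text \<open>
  The Chinese remainder theorem inside \<open>\<Gamma>\<close>: an integer combination \<open>\<Sum> e i *s y i\<close> of representatives
  of the prescribed classes stays in \<open>\<Gamma>\<close>, and it has the right residues when the \<open>e i\<close> are
  the integers of the usual Chinese remainder theorem.
\<close>

lemma neg_class_tuples:
  fixes \<Gamma> :: "(int ^ 'd) set" and m :: "'i \<Rightarrow> nat"
  assumes \<Gamma>: "add_subgroup \<Gamma>" and I: "finite I"
    and cop: "\<And>i j. i \<in> I \<Longrightarrow> j \<in> I \<Longrightarrow> i \<noteq> j \<Longrightarrow> coprime (m i) (m j)"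
  shows "(\<lambda>y. \<lambda>i\<in>I. neg_class (m i) y) ` \<Gamma> = PiE I (\<lambda>i. neg_class (m i) ` \<Gamma>)"
proof
  show "PiE I (\<lambda>i. neg_class (m i) ` \<Gamma>) \<subseteq> (\<lambda>y. \<lambda>i\<in>I. neg_class (m i) y) ` \<Gamma>"
  proof
    fix t assume t: "t \<in> PiE I (\<lambda>i. neg_class (m i) ` \<Gamma>)"
    then have "\<forall>i\<in>I. \<exists>y\<in>\<Gamma>. t i = neg_class (m i) y" by (auto simp: PiE_iff)
    then obtain y where y: "\<And>i. i \<in> I \<Longrightarrow> y i \<in> \<Gamma> \<and> t i = neg_class (m i) (y i)" by metis
    have "\<forall>i. \<exists>e. \<forall>j\<in>I. [e = (if j = i then 1 else 0)] (mod m j)"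
      using I cop by (intro allI chinese_remainder_nat) auto
    then obtain e where e: "\<And>i j. j \<in> I \<Longrightarrow> [e i = (if j = i then 1 else 0)] (mod m j)" by metis
    define z where "z = (\<Sum>i\<in>I. int (e i) *s y i)"
    have "z \<in> \<Gamma>" unfolding z_def using y \<Gamma> by (intro add_subgroup_sum add_subgroup_scale) auto
    moreover have "t j = neg_class (m j) z" if j: "j \<in> I" for j
    proof -
      have "int (m j) dvd (z - y j) $ l" for l
      proof -
        have "(z - y j) $ l = (\<Sum>i\<in>I. int (e i) * y i $ l) - (\<Sum>i\<in>I. (if j = i then 1 else 0) * y i $ l)"
          using I j by (simp add: z_def if_distrib[of "\<lambda>x. x * _"] cong: if_cong)
        also have "\<dots> = (\<Sum>i\<in>I. (int (e i) - (if j = i then 1 else 0)) * y i $ l)"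
          by (simp add: sum_subtractf left_diff_distrib)
        also have "int (m j) dvd \<dots>"
        proof (intro dvd_sum dvd_mult2)
          fix i
          have "[int (e i) = int (if j = i then 1 else 0)] (mod int (m j))"
            using e[OF j, of i] cong_int_iff by blast
          then show "int (m j) dvd int (e i) - (if j = i then 1 else 0)"
            by (auto simp: cong_iff_dvd_diff split: if_splits)
        qed
        finally show ?thesis .
      qed
      then show ?thesis using y[OF j] by (simp add: neg_class_eq_iff dvd_vgcd_iff) (metis dvd_minus_iff minus_diff_eq)
    qed
    then have "t = (\<lambda>i\<in>I. neg_class (m i) z)" using t by (intro ext) (auto simp: PiE_iff extensional_def)
    ultimately show "t \<in> (\<lambda>y. \<lambda>i\<in>I. neg_class (m i) y) ` \<Gamma>" by blast
  qed
qed auto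

section \<open>Subgroups of maximal rank\<close>

lemma zvec_independent_scaled:
  assumes "finite B" "zvec.independent B" "M \<noteq> (0::int)"
  shows "zvec.independent ((*s) M ` B)" "inj_on ((*s) M) B"
proof -
  show inj: "inj_on ((*s) M) B" using assms(3) by (auto simp: inj_on_def vec_eq_iff)
  show "zvec.independent ((*s) M ` B)"
  proof
    assume "zvec.dependent ((*s) M ` B)"
    then obtain u v where u: "v \<in> B" "u (M *s v) \<noteq> 0" "(\<Sum>v\<in>B. u (M *s v) *s (M *s v)) = 0"
      using assms(1) inj by (auto simp: zvec.dependent_finite sum.reindex)
    have "(\<Sum>v\<in>B. (u (M *s v) * M) *s v) = 0" using u(3) by simp
    moreover have "u (M *s v) * M \<noteq> 0" using u(2) assms(3) by simp
    ultimately have "zvec.dependent B"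
      using u(1) unfolding zvec.dependent_finite[OF assms(1)] by (intro exI[of _ "\<lambda>v. u (M *s v) * M"]) blast
    with assms(2) show False by simp
  qed
qed

text \<open>
  The saturation \<open>\<Delta>\<close> of \<open>\<Gamma>\<close>, which consists of the points with a nonzero multiple in \<open>\<Gamma>\<close>, has the
  same rank as \<open>\<Gamma>\<close>, because a finite independent subset of \<open>\<Delta>\<close> is carried into \<open>\<Gamma>\<close> by a common
  nonzero multiplier. Maximality then forces \<open>\<Delta> = \<Gamma>\<close>.
\<close>

lemma maximal_saturated:
  assumes max: "maximal_of_rank k \<Gamma>" and m: "m \<noteq> 0" "m *s x \<in> \<Gamma>"
  shows "x \<in> \<Gamma>"
proof -
  have \<Gamma>: "add_subgroup \<Gamma>" "zrank \<Gamma> = k" using max by (auto simp: maximal_of_rank_def)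
  define \<Delta> where "\<Delta> = {z. \<exists>m. m \<noteq> 0 \<and> m *s z \<in> \<Gamma>}"
  have sub: "\<Gamma> \<subseteq> \<Delta>" unfolding \<Delta>_def by (auto intro!: exI[of _ 1])
  have "add_subgroup \<Delta>"
    unfolding add_subgroup_def
  proof safe
    show "0 \<in> \<Delta>" using sub \<Gamma> by (auto simp: add_subgroup_def)
  next
    fix x y assume "x \<in> \<Delta>" "y \<in> \<Delta>"
    then obtain a b where ab: "a \<noteq> 0" "b \<noteq> 0" "a *s x \<in> \<Gamma>" "b *s y \<in> \<Gamma>" by (auto simp: \<Delta>_def)
    have "(a * b) *s (x + y) = b *s (a *s x) + a *s (b *s y)"
      by (simp add: vec_eq_iff algebra_simps)
    also have "\<dots> \<in> \<Gamma>"
      using add_subgroup_scale[OF \<Gamma>(1) ab(3)] add_subgroup_scale[OF \<Gamma>(1) ab(4)] \<Gamma>(1)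
      unfolding add_subgroup_def by blast
    finally have "(a * b) *s (x + y) \<in> \<Gamma>" .
    then show "x + y \<in> \<Delta>" using ab(1,2) unfolding \<Delta>_def by (intro CollectI exI[of _ "a * b"]) simp
  next
    fix x assume "x \<in> \<Delta>"
    then obtain a where a: "a \<noteq> 0" "a *s x \<in> \<Gamma>" by (auto simp: \<Delta>_def)
    have "a *s (- x) = - (a *s x)" by (simp add: vec_eq_iff)
    then have "a *s (- x) \<in> \<Gamma>" using a \<Gamma> by (simp add: add_subgroup_def)
    then show "- x \<in> \<Delta>" using a by (auto simp: \<Delta>_def)
  qed
  moreover have "{card B | B. finite B \<and> B \<subseteq> \<Delta> \<and> zvec.independent B}
      = {card B | B. finite B \<and> B \<subseteq> \<Gamma> \<and> zvec.independent B}" (is "?L = ?R")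
  proof
    show "?L \<subseteq> ?R"
    proof safe
      fix B assume B: "finite B" "B \<subseteq> \<Delta>" "zvec.independent B"
      then obtain a where a: "\<And>b. b \<in> B \<Longrightarrow> a b \<noteq> 0 \<and> a b *s b \<in> \<Gamma>"
        unfolding \<Delta>_def by (simp add: subset_iff) metis
      define M where "M = prod a B"
      have "M \<noteq> 0" using a B(1) by (auto simp: M_def)
      moreover have "M *s b \<in> \<Gamma>" if "b \<in> B" for b
      proof -
        have "M *s b = prod a (B - {b}) *s (a b *s b)"
          using that B(1) by (simp add: M_def prod.remove[of _ b] mult.commute)
        then show ?thesis using a[OF that] \<Gamma> by (metis add_subgroup_scale)
      qed
      ultimately show "\<exists>B'. card B = card B' \<and> finite B' \<and> B' \<subseteq> \<Gamma> \<and> zvec.independent B'"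
        using zvec_independent_scaled[OF B(1,3)] B(1)
        by (intro exI[of _ "(*s) M ` B"]) (auto simp: card_image)
    qed
  qed (use sub in blast)
  then have "zrank \<Delta> = k" using \<Gamma> by (simp add: zrank_def)
  ultimately have "\<Delta> = \<Gamma>" using max sub by (auto simp: maximal_of_rank_def)
  then show ?thesis using m by (auto simp: \<Delta>_def)
qed

definition rat_vec :: "int ^ 'd \<Rightarrow> rat ^ 'd" where "rat_vec x = (\<chi> i. of_int (x $ i))"

text \<open>
  Clearing denominators lets linear algebra over the field of rationals answer questions about
  integer combinations.
\<close>

lemma common_denominator:
  fixes u :: "'a \<Rightarrow> rat"
  assumes "finite S"
  obtains N :: int and n where "N > 0" "\<And>s. s \<in> S \<Longrightarrow> of_int N * u s = of_int (n s)"
proof -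
  define q where "q s = snd (quotient_of (u s))" for s
  define N where "N = prod q S"
  have q: "q s > 0" for s by (simp add: q_def quotient_of_denom_pos')
  have "\<exists>c::int. of_int N * u s = of_int c" if "s \<in> S" for s
  proof -
    have "u s = of_int (fst (quotient_of (u s))) / of_int (q s)"
      by (metis q_def quotient_of_div prod.collapse)
    then have "of_int (q s) * u s = of_int (fst (quotient_of (u s)))"
      using q[of s] by (simp add: field_simps)
    moreover have "N = prod q (S - {s}) * q s"
      using that assms by (simp add: N_def prod.remove[of _ s] mult.commute)
    ultimately have "of_int N * u s = of_int (prod q (S - {s}) * fst (quotient_of (u s)))"
      by (simp add: mult.assoc)
    then show ?thesis by blast
  qed
  then obtain n where "\<And>s. s \<in> S \<Longrightarrow> of_int N * u s = of_int (n s)" by metis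
  moreover have "N > 0" using q by (simp add: N_def prod_pos)
  ultimately show ?thesis using that by blast
qed

lemma rat_vec_inj: "inj_on rat_vec B"
  by (auto simp: inj_on_def rat_vec_def vec_eq_iff)

lemma rat_vec_0: "rat_vec x = 0 \<longleftrightarrow> x = 0"
  by (simp add: rat_vec_def vec_eq_iff)

lemma rat_vec_sum_scaled:
  assumes "\<And>b. b \<in> B \<Longrightarrow> of_int N * u b = of_int (n b)"
  shows "of_int N *s (\<Sum>b\<in>B. u b *s rat_vec b) = rat_vec (\<Sum>b\<in>B. n b *s b)"
  using assms by (simp add: vec_eq_iff rat_vec_def sum_distrib_left mult.assoc[symmetric])

lemma zvec_independent_card_le:
  fixes B :: "(int ^ 'd) set"
  assumes "finite B" "zvec.independent B" shows "card B \<le> CARD('d)"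
proof -
  have "vec.independent (rat_vec ` B)"
  proof
    assume "vec.dependent (rat_vec ` B)"
    then obtain u v where u: "v \<in> B" "u (rat_vec v) \<noteq> 0" "(\<Sum>b\<in>B. u (rat_vec b) *s rat_vec b) = 0"
      using assms(1) rat_vec_inj[of B] by (auto simp: vec.dependent_finite sum.reindex)
    obtain N n where N: "N > 0" "\<And>b. b \<in> B \<Longrightarrow> of_int N * u (rat_vec b) = of_int (n b)"
      using common_denominator[OF assms(1), of "\<lambda>b. u (rat_vec b)"] by metis
    have "rat_vec (\<Sum>b\<in>B. n b *s b) = 0" using rat_vec_sum_scaled[OF N(2), of B "\<lambda>b. b"] u(3) by simp
    then have "(\<Sum>b\<in>B. n b *s b) = 0" by (simp only: rat_vec_0)
    moreover have "n v \<noteq> 0" using N(1) N(2)[OF u(1)] u(2) by (metis mult_eq_0_iff of_int_0 of_int_eq_0_iff less_irrefl)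
    ultimately show False using assms u(1) by (auto simp: zvec.dependent_finite)
  qed
  then have "card (rat_vec ` B) \<le> vec.dim (UNIV :: (rat ^ 'd) set)"
    by (intro vec.independent_card_le_dim) auto
  then show ?thesis using rat_vec_inj[of B] by (simp add: card_image vec.dim_UNIV card_cart_basis)
qed

text \<open>
  The bound \<open>CARD('d)\<close> on the size of independent sets guarantees that the maximum defining the rank is
  taken over a finite set, and so really is an upper bound.
\<close>

lemma card_le_zrank:
  fixes \<Gamma> :: "(int ^ 'd) set"
  assumes "finite B" "B \<subseteq> \<Gamma>" "zvec.independent B" shows "card B \<le> zrank \<Gamma>"
  unfolding zrank_def
proof (rule Max_ge)
  show "finite {card B |B. finite B \<and> B \<subseteq> \<Gamma> \<and> zvec.independent B}"
    by (rule finite_subset[of _ "{..CARD('d)}"]) (auto intro: zvec_independent_card_le)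
qed (use assms in blast)

lemma zrank_pos_nonzero:
  fixes \<Gamma> :: "(int ^ 'd) set"
  assumes "zrank \<Gamma> \<ge> 1" obtains g where "g \<in> \<Gamma>" "g \<noteq> 0"
proof -
  have "\<exists>g\<in>\<Gamma>. g \<noteq> 0"
  proof (rule ccontr)
    assume "\<not> ?thesis"
    then have sub: "\<Gamma> \<subseteq> {0}" by auto
    have "B = {}" if "B \<subseteq> \<Gamma>" "zvec.independent B" for B
      using that sub zvec.dependent_zero[of B] by auto
    then have "{card B |B. finite B \<and> B \<subseteq> \<Gamma> \<and> zvec.independent B} = {0}"
      by (auto intro!: exI[of _ "{}"] simp: zvec.independent_empty)
    then show False using assms by (simp add: zrank_def)
  qed
  then show ?thesis using that by blast
qed

text \<open>
  Divide a nonzero element by its gcd: the quotient \<open>g\<close> is still in \<open>\<Gamma>\<close> by saturation and is primitive.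
  Any other \<open>y \<in> \<Gamma>\<close> satisfies a relation \<open>a *s g + b *s y = 0\<close>, and primitivity of \<open>g\<close> shows
  that \<open>b\<close> divides \<open>a\<close>.
\<close>

lemma maximal_rank_one_cyclic:
  fixes \<Gamma> :: "(int ^ 'd) set"
  assumes max: "maximal_of_rank 1 \<Gamma>"
  obtains g where "\<Gamma> = range (\<lambda>a. a *s g)"
proof -
  have \<Gamma>: "add_subgroup \<Gamma>" "zrank \<Gamma> = 1" using max by (auto simp: maximal_of_rank_def)
  obtain h where h: "h \<in> \<Gamma>" "h \<noteq> 0" using zrank_pos_nonzero \<Gamma> by (metis order_refl)
  define c where "c = int (vgcd h)"
  have c: "c \<noteq> 0" using h vgcd_eq_0_iff[of h] by (simp add: c_def)
  have "\<forall>i. c dvd h $ i" using dvd_vgcd_iff[of "vgcd h" h] by (simp add: c_def)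
  then have "h = c *s (\<chi> i. h $ i div c)" by (simp add: vec_eq_iff)
  then obtain g where hg: "h = c *s g" by blast
  have g: "g \<in> \<Gamma>" using maximal_saturated[OF max c] hg h by simp
  have g0: "g \<noteq> 0"
  proof
    assume "g = 0"
    then have "h = 0" by (subst hg) (simp add: vec_eq_iff)
    then show False using h by simp
  qed
  have g1: "vgcd g = 1"
  proof -
    have "vgcd h * vgcd g dvd vgcd h"
      unfolding dvd_vgcd_iff[of "_ * _"]
    proof
      fix i
      have "h $ i = c * g $ i" by (subst hg) simp
      then show "int (vgcd h * vgcd g) dvd h $ i"
        using dvd_vgcd_iff[of "vgcd g" g] by (simp add: c_def mult_dvd_mono)
    qed
    then show ?thesis using c by (simp add: c_def)
  qed
  have "y \<in> range (\<lambda>a. a *s g)" if y: "y \<in> \<Gamma>" for y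
  proof (cases "y = g")
    case True
    then have "y = 1 *s g" by simp
    then show ?thesis by blast
  next
    case False
    have "zvec.dependent {g, y}"
    proof (rule ccontr)
      assume "\<not> ?thesis"
      then have "card {g, y} \<le> zrank \<Gamma>" using g y by (intro card_le_zrank) auto
      then show False using False \<Gamma>(2) by simp
    qed
    then obtain u where u: "u g \<noteq> 0 \<or> u y \<noteq> 0" "u g *s g + u y *s y = 0"
      using False by (auto simp: zvec.dependent_finite)
    then have eq: "u g * g $ i + u y * y $ i = 0" for i by (simp add: vec_eq_iff)
    have uy: "u y \<noteq> 0"
    proof
      assume 0: "u y = 0"
      then have "u g \<noteq> 0" using u by simp
      then have "g = 0" using eq 0 by (simp add: vec_eq_iff)
      then show False using g0 by simp
    qed
    have "u y dvd u g * g $ i" for i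
      using eq[of i] by (metis add.commute add_eq_0_iff dvd_minus_iff dvd_triv_left)
    then have "u y dvd (GCD i\<in>UNIV. u g * g $ i)" by (auto intro!: Gcd_greatest)
    moreover have "(GCD i\<in>UNIV. u g * g $ i) = \<bar>u g\<bar> * (GCD i\<in>UNIV. g $ i)"
      using Gcd_mult[of "u g" "range (($) g)"] by (simp add: image_image abs_mult)
    moreover have "(GCD i\<in>UNIV. g $ i) = 1" using g1 by (simp add: vgcd_def)
    ultimately have "u y dvd u g" by simp
    then obtain a where a: "u g = u y * a" by (auto simp: dvd_def)
    have "y = (- a) *s g"
    proof -
      have "u y * (y $ i + a * g $ i) = 0" for i using eq[of i] a by (simp add: algebra_simps)
      then have "y $ i + a * g $ i = 0" for i using uy by (metis mult_eq_0_iff)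
      then show ?thesis by (simp add: vec_eq_iff eq_neg_iff_add_eq_0)
    qed
    then show ?thesis by blast
  qed
  moreover have "range (\<lambda>a. a *s g) \<subseteq> \<Gamma>" using add_subgroup_scale[OF \<Gamma>(1) g] by auto
  ultimately show ?thesis using that by blast
qed

lemma card_neg_class_cyclic_le:
  fixes g :: "int ^ 'd"
  assumes "p > 0" shows "card (neg_class p ` range (\<lambda>a. a *s g)) \<le> p"
proof -
  have "neg_class p ` range (\<lambda>a. a *s g) \<subseteq> (\<lambda>j. neg_class p (int j *s g)) ` {..<p}"
  proof safe
    fix a :: int
    have "neg_class p (a *s g) = neg_class p (int (nat (a mod int p)) *s g)"
      using assms by (simp add: neg_class_eq_iff dvd_vgcd_iff flip: left_diff_distrib)
    moreover have "nat (a mod int p) < p" using assms by (simp add: nat_less_iff)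
    ultimately show "neg_class p (a *s g) \<in> (\<lambda>j. neg_class p (int j *s g)) ` {..<p}" by blast
  qed
  then have "card (neg_class p ` range (\<lambda>a. a *s g)) \<le> card ((\<lambda>j. neg_class p (int j *s g)) ` {..<p})"
    by (intro card_mono) auto
  also have "\<dots> \<le> p" using card_image_le[of "{..<p}" "\<lambda>j. neg_class p (int j *s g)"] by simp
  finally show ?thesis .
qed

text \<open>
  By saturation \<open>x\<close> is outside the rational span of \<open>\<Gamma>\<close>, so a rational linear form vanishes on \<open>\<Gamma>\<close> and not
  at \<open>x\<close>. Scaled to have integer coefficients \<open>n j\<close>, it takes one and the same nonzero value at all
  points \<open>x + y\<close> with \<open>y \<in> \<Gamma>\<close>, and every common divisor of the coordinates of \<open>x + y\<close> divides this value.
\<close>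

lemma vgcd_translates_bounded:
  fixes \<Gamma> :: "(int ^ 'd) set"
  assumes max: "maximal_of_rank k \<Gamma>" and x: "x \<notin> \<Gamma>"
  obtains D where "D > 0" "\<And>y. y \<in> \<Gamma> \<Longrightarrow> vgcd (x + y) dvd D"
proof -
  have \<Gamma>: "add_subgroup \<Gamma>" using max by (auto simp: maximal_of_rank_def)
  have notin: "rat_vec x \<notin> vec.span (rat_vec ` \<Gamma>)"
  proof
    assume "rat_vec x \<in> vec.span (rat_vec ` \<Gamma>)"
    then obtain T u where T: "finite T" "T \<subseteq> rat_vec ` \<Gamma>" "rat_vec x = (\<Sum>a\<in>T. u a *s a)"
      by (auto simp: vec.span_explicit)
    then obtain B where B: "B \<subseteq> \<Gamma>" "finite B" "T = rat_vec ` B"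
      using finite_subset_image[OF T(1,2)] by auto
    have x_eq: "rat_vec x = (\<Sum>b\<in>B. u (rat_vec b) *s rat_vec b)"
      using T(3) B(3) rat_vec_inj[of B] by (simp add: sum.reindex)
    obtain N n where N: "N > 0" "\<And>b. b \<in> B \<Longrightarrow> of_int N * u (rat_vec b) = of_int (n b)"
      using common_denominator[OF B(2), of "\<lambda>b. u (rat_vec b)"] by metis
    have "rat_vec (\<Sum>b\<in>B. n b *s b) = of_int N *s rat_vec x"
      using rat_vec_sum_scaled[OF N(2), of B "\<lambda>b. b"] x_eq by simp
    also have "\<dots> = rat_vec (N *s x)" by (simp add: rat_vec_def vec_eq_iff)
    finally have "N *s x = (\<Sum>b\<in>B. n b *s b)" using rat_vec_inj[of UNIV] by (metis injD)
    also have "\<dots> \<in> \<Gamma>" using B \<Gamma> by (intro add_subgroup_sum add_subgroup_scale) auto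
    finally show False using maximal_saturated[OF max, of N x] N(1) x by auto
  qed
  \<comment> \<open>The linear map \<open>f\<close> below fixes \<open>x\<close> and kills the span of \<open>\<Gamma>\<close>; one of its rows is the wanted form.\<close>
  obtain B where B: "B \<subseteq> rat_vec ` \<Gamma>" "vec.independent B" "rat_vec ` \<Gamma> \<subseteq> vec.span B"
    using vec.maximal_independent_subset by blast
  have span_eq: "vec.span B = vec.span (rat_vec ` \<Gamma>)"
    using B by (intro vec.span_eq[THEN iffD2]) (auto intro: vec.span_base)
  have ind: "vec.independent (insert (rat_vec x) B)"
    using B(2) notin by (auto simp: vec.independent_insert span_eq)
  obtain f where f: "Vector_Spaces.linear (*s) (*s) f"
    and fB: "\<And>b. b \<in> insert (rat_vec x) B \<Longrightarrow> f b = (if b = rat_vec x then rat_vec x else 0)"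
    using vec.linear_independent_extend[OF ind, of "\<lambda>b. if b = rat_vec x then rat_vec x else 0"] by metis
  have f0: "f v = 0" if "v \<in> vec.span B" for v
  proof (rule vec.linear_eq_0_on_span[OF f _ that])
    fix b assume "b \<in> B"
    moreover have "b \<noteq> rat_vec x" using \<open>b \<in> B\<close> notin B(1) by (auto intro: vec.span_base)
    ultimately show "f b = 0" using fB by auto
  qed
  have "x \<noteq> 0" using x \<Gamma> by (auto simp: add_subgroup_def)
  then obtain i where i: "x $ i \<noteq> 0" by (auto simp: vec_eq_iff)
  obtain N n where N: "N > 0" "\<And>j. of_int N * matrix f $ i $ j = of_int (n j)"
    using common_denominator[of UNIV "\<lambda>j. matrix f $ i $ j"] by (metis finite UNIV_I)
  have val: "(\<Sum>j\<in>UNIV. n j * (x + y) $ j) = N * x $ i" if y: "y \<in> \<Gamma>" for y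
  proof -
    have "f (rat_vec (x + y)) = f (rat_vec x + rat_vec y)"
      by (rule arg_cong[of _ _ f]) (simp add: rat_vec_def vec_eq_iff)
    also have "\<dots> = f (rat_vec x) + f (rat_vec y)" by (rule vec.linear_add[OF f])
    also have "f (rat_vec y) = 0" using y by (intro f0) (auto simp: span_eq intro: vec.span_base)
    also have "f (rat_vec x) = rat_vec x" using fB by simp
    finally have "matrix f *v rat_vec (x + y) = rat_vec x"
      using matrix_works[OF f] by (metis add.right_neutral)
    then have "(\<Sum>j\<in>UNIV. matrix f $ i $ j * rat_vec (x + y) $ j) = of_int (x $ i)"
      by (auto simp: vec_eq_iff matrix_vector_mult_def rat_vec_def)
    then have "of_int N * (\<Sum>j\<in>UNIV. matrix f $ i $ j * rat_vec (x + y) $ j) = of_int (N * x $ i)"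
      by simp
    moreover have "of_int N * (\<Sum>j\<in>UNIV. matrix f $ i $ j * rat_vec (x + y) $ j)
        = of_int (\<Sum>j\<in>UNIV. n j * (x + y) $ j)"
      using N(2) by (simp add: sum_distrib_left rat_vec_def mult.assoc[symmetric])
    ultimately show ?thesis by (metis of_int_eq_iff)
  qed
  have "vgcd (x + y) dvd nat \<bar>N * x $ i\<bar>" if y: "y \<in> \<Gamma>" for y
  proof -
    have "int (vgcd (x + y)) dvd (\<Sum>j\<in>UNIV. n j * (x + y) $ j)"
      using dvd_vgcd_iff[of "vgcd (x + y)" "x + y"] by (intro dvd_sum dvd_mult) auto
    then show ?thesis unfolding val[OF y] by (simp add: nat_abs_dvd_iff dvd_nat_abs_iff)
  qed
  moreover have "nat \<bar>N * x $ i\<bar> > 0" using i N(1) by simp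
  ultimately show ?thesis using that by blast
qed

section \<open>Equidistribution along Foelner sequences\<close>

lemma card_sym_diff_bound:
  assumes "finite A" "finite B"
  shows "\<bar>real (card (A \<inter> S)) - real (card (B \<inter> S))\<bar> \<le> real (card (sym_diff A B))"
proof -
  have *: "card (A \<inter> S) \<le> card (B \<inter> S) + card (sym_diff A B)" if "finite A" "finite B" for A B :: "'a set"
  proof -
    have "card (A \<inter> S) \<le> card ((B \<inter> S) \<union> sym_diff A B)" using that by (intro card_mono) auto
    also have "\<dots> \<le> card (B \<inter> S) + card (sym_diff A B)" by (rule card_Un_le)
    finally show ?thesis .
  qed
  show ?thesis using *[OF assms] *[OF assms(2,1)] by (simp add: Un_commute)
qed

text \<open>The uniform laws on \<open>F n\<close> are asymptotically invariant under translations by \<open>\<Gamma>\<close>.\<close>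

lemma Folner_shift:
  assumes F: "Folner_sequence \<Gamma> F" and g: "g \<in> \<Gamma>"
  shows "(\<lambda>n. measure_pmf.prob (pmf_of_set (F n)) {y. Q (y + g)}
            - measure_pmf.prob (pmf_of_set (F n)) {y. Q y}) \<longlonglongrightarrow> 0"
proof (rule Lim_null_comparison)
  let ?D = "\<lambda>n. real (card (sym_diff (F n) ((\<lambda>x. x + g) ` F n)))"
  have fin: "finite (F n)" "F n \<noteq> {}" for n using F by (auto simp: Folner_sequence_def)
  show "(\<lambda>n. ?D n / real (card (F n))) \<longlonglongrightarrow> 0"
    using F g by (intro smalloD_tendsto) (auto simp: Folner_sequence_def)
  show "\<forall>\<^sub>F n in sequentially. norm (measure_pmf.prob (pmf_of_set (F n)) {y. Q (y + g)}
            - measure_pmf.prob (pmf_of_set (F n)) {y. Q y}) \<le> ?D n / real (card (F n))"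
  proof (intro always_eventually allI)
    fix n
    have "(\<lambda>x. x + g) ` (F n \<inter> {y. Q (y + g)}) = (\<lambda>x. x + g) ` F n \<inter> {y. Q y}" by auto
    then have "card (F n \<inter> {y. Q (y + g)}) = card ((\<lambda>x. x + g) ` F n \<inter> {y. Q y})"
      by (metis add_right_imp_eq card_image inj_onI)
    then have "\<bar>real (card (F n \<inter> {y. Q (y + g)})) - real (card (F n \<inter> {y. Q y}))\<bar> \<le> ?D n"
      using card_sym_diff_bound[of "F n" "(\<lambda>x. x + g) ` F n" "{y. Q y}"] fin by simp
    then show "norm (measure_pmf.prob (pmf_of_set (F n)) {y. Q (y + g)}
            - measure_pmf.prob (pmf_of_set (F n)) {y. Q y}) \<le> ?D n / real (card (F n))"
      using fin[of n] by (simp add: measure_pmf_of_set divide_right_mono flip: diff_divide_distrib)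
  qed
qed

text \<open>
  Here \<open>c\<close> is the quotient map of a translation-invariant equivalence relation on \<open>\<Gamma>\<close> with finitely many
  classes. Translations permute the classes transitively, so by asymptotic invariance any two
  classes have asymptotically equal probabilities. As these sum to one, each tends to
  the inverse of the number of classes.
\<close>

lemma Folner_equidistributed:
  assumes F: "Folner_sequence \<Gamma> F" and \<Gamma>: "add_subgroup \<Gamma>"
    and c: "\<And>y y' g. y \<in> \<Gamma> \<Longrightarrow> y' \<in> \<Gamma> \<Longrightarrow> g \<in> \<Gamma> \<Longrightarrow> c y = c y' \<Longrightarrow> c (y + g) = c (y' + g)"
    and fin: "finite (c ` \<Gamma>)" and t: "t \<in> c ` \<Gamma>"
  shows "(\<lambda>n. measure_pmf.prob (pmf_of_set (F n)) {y. c y = t}) \<longlonglongrightarrow> 1 / real (card (c ` \<Gamma>))"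
proof -
  let ?P = "\<lambda>n s. measure_pmf.prob (pmf_of_set (F n)) {y. c y = s}"
  let ?T = "c ` \<Gamma>"
  have Fn: "finite (F n)" "F n \<noteq> {}" "F n \<subseteq> \<Gamma>" for n using F by (auto simp: Folner_sequence_def)
  have diff: "(\<lambda>n. ?P n s - ?P n s') \<longlonglongrightarrow> 0" if s: "s \<in> ?T" "s' \<in> ?T" for s s'
  proof -
    obtain a b where ab: "a \<in> \<Gamma>" "b \<in> \<Gamma>" "s = c a" "s' = c b" using s by auto
    define g where "g = b - a"
    have g: "g \<in> \<Gamma>" "- g \<in> \<Gamma>"
      using ab add_subgroup_diff[OF \<Gamma>] \<Gamma> by (auto simp: g_def add_subgroup_def)
    have iff: "c (y + g) = s' \<longleftrightarrow> c y = s" if y: "y \<in> \<Gamma>" for y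
    proof
      assume "c (y + g) = s'"
      then have "c (y + g + - g) = c (b + - g)"
        using ab g y \<Gamma> by (intro c) (auto simp: add_subgroup_def)
      then show "c y = s" using ab by (simp add: g_def)
    next
      assume "c y = s"
      then have "c (y + g) = c (a + g)" using ab g y by (intro c) auto
      then show "c (y + g) = s'" using ab by (simp add: g_def)
    qed
    have "F n \<inter> {y. c (y + g) = s'} = F n \<inter> {y. c y = s}" for n using iff Fn(3)[of n] by auto
    then have "measure_pmf.prob (pmf_of_set (F n)) {y. c (y + g) = s'} = ?P n s" for n
      using Fn by (simp add: measure_pmf_of_set)
    then show ?thesis using Folner_shift[OF F g(1), of "\<lambda>y. c y = s'"] by simp
  qed
  have total: "(\<Sum>s\<in>?T. ?P n s) = 1" for n
  proof -
    have "(\<Sum>s\<in>?T. ?P n s) = measure_pmf.prob (pmf_of_set (F n)) (\<Union>s\<in>?T. {y. c y = s})"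
      using fin by (intro measure_pmf.finite_measure_finite_Union[symmetric]) (auto simp: disjoint_family_on_def)
    also have "\<dots> = 1"
    proof -
      have "AE y in pmf_of_set (F n). y \<in> (\<Union>s\<in>?T. {y. c y = s})"
      proof (rule AE_pmfI)
        fix y assume "y \<in> set_pmf (pmf_of_set (F n))"
        then have "y \<in> \<Gamma>" using Fn[of n] by (auto simp: set_pmf_of_set)
        then show "y \<in> (\<Union>s\<in>?T. {y. c y = s})" by auto
      qed
      then show ?thesis by (subst measure_pmf.prob_eq_1) auto
    qed
    finally show ?thesis .
  qed
  have N: "card ?T > 0" using fin t by (auto simp: card_gt_0_iff)
  have "(\<lambda>n. (\<Sum>s\<in>?T. ?P n t - ?P n s) / card ?T + 1 / card ?T) \<longlonglongrightarrow> (\<Sum>s\<in>?T. 0) / card ?T + 1 / card ?T"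
    using N t by (intro tendsto_intros diff) auto
  moreover have "(\<Sum>s\<in>?T. ?P n t - ?P n s) / card ?T + 1 / card ?T = ?P n t" for n
    using N total[of n] by (simp add: sum_subtractf field_simps)
  ultimately show ?thesis by simp
qed

lemma Folner_expectation:
  fixes \<phi> :: "int ^ 'd \<Rightarrow> real"
  assumes F: "Folner_sequence \<Gamma> F" and \<Gamma>: "add_subgroup \<Gamma>"
    and c: "\<And>y y' g. y \<in> \<Gamma> \<Longrightarrow> y' \<in> \<Gamma> \<Longrightarrow> g \<in> \<Gamma> \<Longrightarrow> c y = c y' \<Longrightarrow> c (y + g) = c (y' + g)"
    and fin: "finite (c ` \<Gamma>)" and \<phi>: "\<And>y. y \<in> \<Gamma> \<Longrightarrow> \<phi> y = \<psi> (c y)"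
  shows "(\<lambda>n. measure_pmf.expectation (pmf_of_set (F n)) \<phi>) \<longlonglongrightarrow> (\<Sum>t\<in>c ` \<Gamma>. \<psi> t * (1 / card (c ` \<Gamma>)))"
proof -
  have Fn: "finite (F n)" "F n \<noteq> {}" "F n \<subseteq> \<Gamma>" for n using F by (auto simp: Folner_sequence_def)
  have "measure_pmf.expectation (pmf_of_set (F n)) \<phi>
      = (\<Sum>t\<in>c ` \<Gamma>. \<psi> t * measure_pmf.prob (pmf_of_set (F n)) {y. c y = t})" for n
  proof -
    have "measure_pmf.expectation (pmf_of_set (F n)) \<phi>
        = measure_pmf.expectation (pmf_of_set (F n)) (\<lambda>y. \<Sum>t\<in>c ` \<Gamma>. \<psi> t * indicator {y. c y = t} y)"
    proof (intro integral_cong_AE AE_pmfI)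
      fix y assume "y \<in> set_pmf (pmf_of_set (F n))"
      then have y: "y \<in> \<Gamma>" using Fn[of n] by auto
      have "(\<Sum>t\<in>c ` \<Gamma>. \<psi> t * indicator {y. c y = t} y) = (\<Sum>t\<in>c ` \<Gamma>. if t = c y then \<psi> t else 0)"
        by (intro sum.cong) (auto simp: indicator_def)
      then show "\<phi> y = (\<Sum>t\<in>c ` \<Gamma>. \<psi> t * indicator {y. c y = t} y)"
        using fin y by (simp add: \<phi>)
    qed auto
    also have "\<dots> = (\<Sum>t\<in>c ` \<Gamma>. \<psi> t * measure_pmf.prob (pmf_of_set (F n)) {y. c y = t})"
      by (subst Bochner_Integration.integral_sum) (auto simp: measure_pmf.emeasure_eq_measure)
    finally show ?thesis .
  qed
  moreover have "(\<lambda>n. \<Sum>t\<in>c ` \<Gamma>. \<psi> t * measure_pmf.prob (pmf_of_set (F n)) {y. c y = t})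
      \<longlonglongrightarrow> (\<Sum>t\<in>c ` \<Gamma>. \<psi> t * (1 / card (c ` \<Gamma>)))"
    by (intro tendsto_sum tendsto_mult[OF tendsto_const] Folner_equidistributed[OF F \<Gamma> c fin])
  ultimately show ?thesis by simp
qed

text \<open>
  If the \<open>i\<close>-th coordinate of \<open>g\<close> is not zero, then the multiples \<open>j *s g\<close> with \<open>j < J\<close> are
  pairwise incongruent modulo \<open>p ^ n\<close> once \<open>p ^ n > J * \<bar>g $ i\<bar>\<close>.
\<close>

lemma card_neg_class_at_top:
  fixes \<Gamma> :: "(int ^ 'd) set"
  assumes \<Gamma>: "add_subgroup \<Gamma>" and g: "g \<in> \<Gamma>" "g \<noteq> 0" and p: "p \<ge> 2"
  shows "filterlim (\<lambda>n. card (neg_class (p ^ n) ` \<Gamma>)) at_top sequentially"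
  unfolding filterlim_at_top
proof
  fix J :: nat
  obtain i where i: "g $ i \<noteq> 0" using g by (auto simp: vec_eq_iff)
  show "\<forall>\<^sub>F n in sequentially. J \<le> card (neg_class (p ^ n) ` \<Gamma>)"
    unfolding eventually_sequentially
  proof (intro exI allI impI)
    fix n assume n: "n \<ge> J * nat \<bar>g $ i\<bar>"
    have "n < p ^ n" using p by (intro power_gt_expt) simp
    then have big: "int J * \<bar>g $ i\<bar> < int (p ^ n)" using n by (metis (no_types, lifting) abs_ge_zero int_nat_eq less_le_trans of_nat_less_iff of_nat_mult order.strict_trans1)
    have inj: "inj_on (\<lambda>j. neg_class (p ^ n) (int j *s g)) {..<J}"
    proof (rule inj_onI)
      fix a b assume ab: "a \<in> {..<J}" "b \<in> {..<J}"
        and eq: "neg_class (p ^ n) (int a *s g) = neg_class (p ^ n) (int b *s g)"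
      have "int (p ^ n) dvd (int a - int b) * g $ i"
        using eq by (simp add: neg_class_eq_iff dvd_vgcd_iff left_diff_distrib)
      moreover have "\<bar>(int a - int b) * g $ i\<bar> < int (p ^ n)"
      proof -
        have "\<bar>(int a - int b) * g $ i\<bar> \<le> int J * \<bar>g $ i\<bar>"
          using ab by (auto simp: abs_mult intro!: mult_right_mono)
        then show ?thesis using big by simp
      qed
      ultimately have "(int a - int b) * g $ i = 0"
        using dvd_imp_le_int[of "(int a - int b) * g $ i" "int (p ^ n)"] by linarith
      then show "a = b" using i by simp
    qed
    have "J = card ((\<lambda>j. neg_class (p ^ n) (int j *s g)) ` {..<J})" using card_image[OF inj] by simp
    also have "\<dots> \<le> card (neg_class (p ^ n) ` \<Gamma>)"
      using p add_subgroup_scale[OF \<Gamma> g(1)] by (intro card_mono finite_neg_class_image) auto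
    finally show "J \<le> card (neg_class (p ^ n) ` \<Gamma>)" .
  qed
qed

text \<open>A point is contained in its residue class modulo \<open>2 ^ m\<close>, whose limiting probability is small for large \<open>m\<close>.\<close>

lemma Folner_point_null:
  assumes F: "Folner_sequence \<Gamma> F" and \<Gamma>: "add_subgroup \<Gamma>" and g: "g \<in> \<Gamma>" "g \<noteq> 0"
  shows "(\<lambda>n. measure_pmf.prob (pmf_of_set (F n)) {z}) \<longlonglongrightarrow> 0"
proof (cases "z \<in> \<Gamma>")
  case False
  have "measure_pmf.prob (pmf_of_set (F n)) {z} = 0" for n
  proof -
    have "F n \<inter> {z} = {}" "finite (F n)" "F n \<noteq> {}" using F False by (auto simp: Folner_sequence_def)
    then show ?thesis by (simp add: measure_pmf_of_set)
  qed
  then show ?thesis by simp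
next
  case True
  show ?thesis
  proof (rule order_tendstoI)
    fix e :: real assume e: "0 < e"
    have "eventually (\<lambda>n. card (neg_class (2 ^ n) ` \<Gamma>) \<ge> nat \<lceil>1 / e\<rceil> + 1) sequentially"
      using card_neg_class_at_top[OF \<Gamma> g, of 2] by (auto simp: filterlim_at_top)
    then obtain m where m: "card (neg_class (2 ^ m) ` \<Gamma>) \<ge> nat \<lceil>1 / e\<rceil> + 1"
      by (auto simp: eventually_sequentially)
    let ?N = "real (card (neg_class (2 ^ m) ` \<Gamma>))"
    have N: "?N > 1 / e" using m by linarith
    then have "1 / ?N < e" using e by (smt (verit) divide_less_eq mult.commute divide_pos_pos)
    moreover have "(\<lambda>n. measure_pmf.prob (pmf_of_set (F n)) {y. neg_class (2 ^ m) y = neg_class (2 ^ m) z}) \<longlonglongrightarrow> 1 / ?N"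
      using True by (intro Folner_equidistributed[OF F \<Gamma>] finite_neg_class_image) (auto simp: neg_class_eq_iff)
    ultimately have "eventually (\<lambda>n. measure_pmf.prob (pmf_of_set (F n)) {y. neg_class (2 ^ m) y = neg_class (2 ^ m) z} < e) sequentially"
      by (intro order_tendstoD(2))
    then show "eventually (\<lambda>n. measure_pmf.prob (pmf_of_set (F n)) {z} < e) sequentially"
    proof eventually_elim
      case (elim n)
      have "measure_pmf.prob (pmf_of_set (F n)) {z} \<le> measure_pmf.prob (pmf_of_set (F n)) {y. neg_class (2 ^ m) y = neg_class (2 ^ m) z}"
        by (intro measure_pmf.finite_measure_mono) auto
      then show ?case using elim by simp
    qed
  next
    fix a :: real assume "a < 0"
    then show "eventually (\<lambda>n. a < measure_pmf.prob (pmf_of_set (F n)) {z}) sequentially"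
      by (intro always_eventually allI) (rule less_le_trans, auto)
  qed
qed

section \<open>The law of the coset chain of one prime\<close>

lemma (in Ionescu_Tulcea) distr_lim_initial:
  "distr PF.lim (PiM {0..<n} M) (\<lambda>x. restrict x {0..<n}) = C 0 n (\<lambda>_. undefined)"
proof -
  have u: "up_to {0..<n} = n" unfolding up_to_def by (rule Least_equality) (auto simp: not_le[symmetric])
  have "distr (C 0 n (\<lambda>_. undefined)) (PiM {0..<0 + n} M) (\<lambda>x. restrict x {0..<0 + n}) = C 0 n (\<lambda>_. undefined)"
    by (rule distr_C[symmetric]) auto
  then show ?thesis by (simp add: distr_lim CI_def u)
qed

lemma (in Ionescu_Tulcea) prob_space_lim: "prob_space PF.lim"
proof (rule prob_space_distrD)
  show "(\<lambda>x. restrict x {0..<0}) \<in> measurable PF.lim (PiM {0..<0::nat} M)" by (auto intro!: measurable_restrict)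
  show "prob_space (distr PF.lim (PiM {0..<0} M) (\<lambda>x. restrict x {0..<0}))"
    unfolding distr_lim_initial by (rule prob_space_C) auto
qed

text \<open>
  The Markov property of the infinite chain: coordinate \<open>n\<close> can be integrated out against its
  transition kernel, given the earlier coordinates.
\<close>

lemma (in Ionescu_Tulcea) nn_integral_lim_Suc:
  assumes f[measurable]: "f \<in> borel_measurable (PiM {0..<Suc n} M)"
  shows "(\<integral>\<^sup>+w. f (restrict w {0..<Suc n}) \<partial>PF.lim)
    = (\<integral>\<^sup>+w. (\<integral>\<^sup>+x. f ((restrict w {0..<n})(n := x)) \<partial>P n (restrict w {0..<n})) \<partial>PF.lim)"
proof -
  have r: "(\<lambda>x. restrict x {0..<m}) \<in> measurable PF.lim (PiM {0..<m} M)" for m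
    by (subst measurable_cong_sets[OF PF.sets_lim refl]) (auto intro!: measurable_restrict)
  have sC: "sets (C 0 n (\<lambda>_. undefined)) = sets (PiM {0..<n} M)" by (simp add: sets_C)
  have eP: "eP n \<in> measurable (C 0 n (\<lambda>_. undefined)) (subprob_algebra (PiM {0..<Suc n} M))"
    by (subst measurable_cong_sets[OF sC refl]) (rule measurable_eP)
  have meas: "(\<lambda>w. \<integral>\<^sup>+x. f x \<partial>eP n w) \<in> borel_measurable (PiM {0..<n} M)"
    by (rule nn_integral_measurable_subprob_algebra2[OF _ measurable_eP]) auto
  have "(\<integral>\<^sup>+w. f (restrict w {0..<Suc n}) \<partial>PF.lim) = (\<integral>\<^sup>+w. f w \<partial>C 0 (Suc n) (\<lambda>_. undefined))"
    unfolding distr_lim_initial[symmetric] by (subst nn_integral_distr[OF r]) auto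
  also have "\<dots> = (\<integral>\<^sup>+w. (\<integral>\<^sup>+x. f x \<partial>eP n w) \<partial>C 0 n (\<lambda>_. undefined))"
    using nn_integral_bind[OF f eP] by simp
  also have "\<dots> = (\<integral>\<^sup>+w. (\<integral>\<^sup>+x. f x \<partial>eP n (restrict w {0..<n})) \<partial>PF.lim)"
    unfolding distr_lim_initial[symmetric] by (subst nn_integral_distr[OF r]) (auto intro: meas)
  also have "\<dots> = (\<integral>\<^sup>+w. (\<integral>\<^sup>+x. f ((restrict w {0..<n})(n := x)) \<partial>P n (restrict w {0..<n})) \<partial>PF.lim)"
    by (intro nn_integral_cong nn_integral_eP f) (auto simp: space_PiM)
  finally show ?thesis .
qed

lemma sets_coset_chain_law [measurable_cong]:
  "sets (coset_chain_law \<Gamma> p) = sets (PiM UNIV (\<lambda>_. count_space UNIV))"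
  by (simp add: coset_chain_law_def)

lemma space_coset_chain_law [simp]: "space (coset_chain_law \<Gamma> p) = UNIV"
  by (simp add: coset_chain_law_def space_PiM)

lemma prob_space_coset_chain_law: "prob_space (coset_chain_law \<Gamma> p)"
  unfolding coset_chain_law_def by (rule coset.prob_space_lim)

lemma measurable_chain_component [measurable]:
  "(\<lambda>w. w n) \<in> measurable (coset_chain_law \<Gamma> p) (count_space UNIV)"
  by measurable

lemma pred_chain_component [measurable]: "Measurable.pred (coset_chain_law \<Gamma> p) (\<lambda>w. Q (w n))"
  by (rule measurable_compose[OF measurable_chain_component]) simp

lemma sets_chain_Collect:
  "Measurable.pred (coset_chain_law \<Gamma> p) Q \<Longrightarrow> {w. Q w} \<in> sets (coset_chain_law \<Gamma> p)"
  by (simp add: pred_def)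

lemma chain_start: "emeasure (coset_chain_law \<Gamma> p) {w. w 0 = UNIV} = 1"
proof -
  have "(\<integral>\<^sup>+w. indicator {UNIV} (restrict w {0..<Suc 0} 0) \<partial>coset_chain_law \<Gamma> p)
      = (\<integral>\<^sup>+w. (\<integral>\<^sup>+x. indicator {UNIV} (((restrict w {0..<0})(0 := x)) 0) \<partial>coset_kernel \<Gamma> p 0 (restrict w {0..<0})) \<partial>coset_chain_law \<Gamma> p)"
    unfolding coset_chain_law_def
    by (rule coset.nn_integral_lim_Suc) (auto intro!: measurable_compose[OF measurable_component_singleton])
  also have "\<dots> = 1"
    using prob_space.emeasure_space_1[OF prob_space_coset_chain_law, of \<Gamma> p] by (simp add: coset_kernel_def)
  also have "(\<integral>\<^sup>+w. indicator {UNIV} (restrict w {0..<Suc 0} 0) \<partial>coset_chain_law \<Gamma> p)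
     = (\<integral>\<^sup>+w. indicator {w. w 0 = UNIV} w \<partial>coset_chain_law \<Gamma> p)"
    by (intro nn_integral_cong) (auto simp: indicator_def)
  also have "\<dots> = emeasure (coset_chain_law \<Gamma> p) {w. w 0 = UNIV}"
    by (intro nn_integral_indicator sets_chain_Collect) measurable
  finally show ?thesis .
qed

definition coset_children :: "(int ^ 'd) set \<Rightarrow> nat \<Rightarrow> (int ^ 'd) set \<Rightarrow> (int ^ 'd) set set" where
  "coset_children \<Gamma> m A = {C \<in> cosets_of m. C \<subseteq> A \<and> C \<inter> \<Gamma> \<noteq> {}}"

text \<open>
  Single values are singled out because the space of all sets of vectors is uncountable, so that
  joint events of two coordinates are best handled point by point.
\<close>

lemma chain_joint:
  fixes \<Gamma> :: "(int ^ 'd) set"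
  shows
  "emeasure (coset_chain_law \<Gamma> p) {w. w k = A \<and> w (Suc k) = C}
    = emeasure (coset_chain_law \<Gamma> p) {w. w k = A} * ennreal (pmf (pmf_of_set (coset_children \<Gamma> (p ^ Suc k) A)) C)"
proof -
  let ?L = "coset_chain_law \<Gamma> p"
  let ?\<kappa> = "pmf_of_set (coset_children \<Gamma> (p ^ Suc k) A)"
  have m: "(\<lambda>w. indicator {B} (w j) :: ennreal) \<in> borel_measurable (PiM {0..<Suc (Suc k)} (\<lambda>_. count_space UNIV))"
    if "j < Suc (Suc k)" for B :: "(int ^ 'd) set" and j
    using that by (intro measurable_compose[OF measurable_component_singleton]) auto
  have "(\<integral>\<^sup>+w. (indicator {A} (restrict w {0..<Suc (Suc k)} k) * indicator {C} (restrict w {0..<Suc (Suc k)} (Suc k)) :: ennreal) \<partial>?L)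
      = (\<integral>\<^sup>+w. (\<integral>\<^sup>+x. indicator {A} (((restrict w {0..<Suc k})(Suc k := x)) k) * indicator {C} (((restrict w {0..<Suc k})(Suc k := x)) (Suc k)) \<partial>coset_kernel \<Gamma> p (Suc k) (restrict w {0..<Suc k})) \<partial>?L)"
    unfolding coset_chain_law_def
    by (rule coset.nn_integral_lim_Suc[where f = "\<lambda>w. indicator {A} (w k) * indicator {C} (w (Suc k))"])
       (intro borel_measurable_times_ennreal m; simp)
  also have "\<dots> = (\<integral>\<^sup>+w. indicator {w. w k = A} w * (\<integral>\<^sup>+x. indicator {C} x \<partial>measure_pmf ?\<kappa>) \<partial>?L)"
    by (intro nn_integral_cong) (auto simp: indicator_def coset_kernel_def coset_children_def)
  also have "\<dots> = (\<integral>\<^sup>+w. ennreal (pmf ?\<kappa> C) * indicator {w. w k = A} w \<partial>?L)"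
    by (intro nn_integral_cong) (simp add: emeasure_pmf_single mult.commute)
  also have "\<dots> = ennreal (pmf ?\<kappa> C) * emeasure ?L {w. w k = A}"
    by (intro nn_integral_cmult_indicator sets_chain_Collect) measurable
  also have "(\<integral>\<^sup>+w. (indicator {A} (restrict w {0..<Suc (Suc k)} k) * indicator {C} (restrict w {0..<Suc (Suc k)} (Suc k)) :: ennreal) \<partial>?L)
     = (\<integral>\<^sup>+w. indicator {w. w k = A \<and> w (Suc k) = C} w \<partial>?L)"
    by (intro nn_integral_cong) (auto simp: indicator_def)
  also have "\<dots> = emeasure ?L {w. w k = A \<and> w (Suc k) = C}"
    by (intro nn_integral_indicator sets_chain_Collect) measurable
  finally show ?thesis by (simp add: mult.commute)
qed

text \<open>
  The classes of successive powers of \<open>p\<close> form a tree. The following lemmas show that every class has exactly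
  one parent, and that translation by \<open>\<Gamma>\<close> makes the number of children independent of the class.
\<close>

lemma neg_class_subset_iff:
  assumes "m' dvd m"
  shows "neg_class m z \<subseteq> neg_class m' y \<longleftrightarrow> m' dvd vgcd (z - y)"
proof
  assume "neg_class m z \<subseteq> neg_class m' y"
  moreover have "- z \<in> neg_class m z" by (simp add: neg_class_def dvd_vgcd_iff)
  ultimately have "- z \<in> neg_class m' y" by blast
  then have "m' dvd vgcd (- (z - y))" by (simp add: neg_class_def)
  then show "m' dvd vgcd (z - y)" by (simp only: dvd_vgcd_uminus)
next
  assume *: "m' dvd vgcd (z - y)"
  show "neg_class m z \<subseteq> neg_class m' y"
  proof
    fix w assume "w \<in> neg_class m z"
    then have "m' dvd vgcd (w + z)" using assms by (auto simp: neg_class_def)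
    then have "m' dvd vgcd ((w + z) - (z - y))" using * by (rule dvd_vgcd_diff)
    then show "w \<in> neg_class m' y" by (simp add: neg_class_def)
  qed
qed

lemma neg_class_mem_children_iff:
  assumes \<Gamma>: "add_subgroup \<Gamma>" and m: "m' dvd m" and z: "z \<in> \<Gamma>" and A: "A \<in> neg_class m' ` \<Gamma>"
  shows "neg_class m z \<in> coset_children \<Gamma> m A \<longleftrightarrow> A = neg_class m' z"
proof -
  obtain y where y: "A = neg_class m' y" using A by auto
  have "neg_class m z \<in> {C \<in> cosets_of m. C \<inter> \<Gamma> \<noteq> {}}" using z cosets_meeting_eq[OF \<Gamma>] by blast
  then have "neg_class m z \<in> coset_children \<Gamma> m A \<longleftrightarrow> neg_class m z \<subseteq> A" by (auto simp: coset_children_def)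
  also have "\<dots> \<longleftrightarrow> neg_class m' z = neg_class m' y" by (simp add: y neg_class_subset_iff[OF m] neg_class_eq_iff)
  finally show ?thesis by (auto simp: y)
qed

lemma coset_children_subset:
  assumes "add_subgroup \<Gamma>" shows "coset_children \<Gamma> m A \<subseteq> neg_class m ` \<Gamma>"
  using cosets_meeting_eq[OF assms, of m] by (auto simp: coset_children_def)

lemma card_coset_children:
  assumes \<Gamma>: "add_subgroup \<Gamma>" and m: "m' dvd m" and A: "A \<in> neg_class m' ` \<Gamma>"
  shows "card (coset_children \<Gamma> m A) = card (coset_children \<Gamma> m (neg_class m' 0))"
proof -
  obtain y where y: "y \<in> \<Gamma>" "A = neg_class m' y" using A by auto
  have 0: "neg_class m' 0 \<in> neg_class m' ` \<Gamma>" using \<Gamma> by (auto simp: add_subgroup_def)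
  have tr: "neg_class l (z - y) = (+) y ` neg_class l z" for l z
  proof (intro set_eqI iffI)
    fix w assume "w \<in> neg_class l (z - y)"
    then have "w - y \<in> neg_class l z" by (simp add: neg_class_def algebra_simps)
    then show "w \<in> (+) y ` neg_class l z" by (intro image_eqI[of _ _ "w - y"]) auto
  qed (auto simp: neg_class_def algebra_simps)
  have "coset_children \<Gamma> m (neg_class m' 0) = image ((+) y) ` coset_children \<Gamma> m A"
  proof (intro set_eqI iffI)
    fix C assume C: "C \<in> coset_children \<Gamma> m (neg_class m' 0)"
    then obtain z where z: "z \<in> \<Gamma>" "C = neg_class m z" using coset_children_subset[OF \<Gamma>] by blast
    have zy: "z + y \<in> \<Gamma>" using \<Gamma> z y by (simp add: add_subgroup_def)
    have "m' dvd vgcd z"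
      using C z neg_class_mem_children_iff[OF \<Gamma> m z(1) 0] by (metis neg_class_eq_iff diff_zero)
    then have "neg_class m (z + y) \<in> coset_children \<Gamma> m A"
      using neg_class_mem_children_iff[OF \<Gamma> m zy A] by (simp add: y neg_class_eq_iff dvd_vgcd_iff)
    moreover have "C = (+) y ` neg_class m (z + y)" using tr[of m "z + y"] z by simp
    ultimately show "C \<in> image ((+) y) ` coset_children \<Gamma> m A" by blast
  next
    fix C assume "C \<in> image ((+) y) ` coset_children \<Gamma> m A"
    then obtain B where B: "B \<in> coset_children \<Gamma> m A" "C = (+) y ` B" by blast
    then obtain z where z: "z \<in> \<Gamma>" "B = neg_class m z" using coset_children_subset[OF \<Gamma>] by blast
    have zy: "z - y \<in> \<Gamma>" using add_subgroup_diff[OF \<Gamma> z(1) y(1)] .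
    have "C = neg_class m (z - y)" using tr B z by simp
    moreover have "m' dvd vgcd (y - z)"
      using B z neg_class_mem_children_iff[OF \<Gamma> m z(1) A] y by (metis neg_class_eq_iff)
    ultimately show "C \<in> coset_children \<Gamma> m (neg_class m' 0)"
      using neg_class_mem_children_iff[OF \<Gamma> m zy 0] by (simp add: neg_class_eq_iff)
  qed
  moreover have "inj_on (image ((+) y)) (coset_children \<Gamma> m A)"
    by (auto simp: inj_on_def inj_image_eq_iff)
  ultimately show ?thesis by (simp add: card_image)
qed

lemma card_neg_class_children:
  assumes \<Gamma>: "add_subgroup \<Gamma>" and m: "m' dvd m" "m > 0"
  shows "card (neg_class m ` \<Gamma>) = card (neg_class m' ` \<Gamma>) * card (coset_children \<Gamma> m (neg_class m' 0))"
proof -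
  have m': "m' > 0" using m by (metis dvd_0_left_iff gr0I)
  have "neg_class m ` \<Gamma> = (\<Union>A\<in>neg_class m' ` \<Gamma>. coset_children \<Gamma> m A)"
    using coset_children_subset[OF \<Gamma>] neg_class_mem_children_iff[OF \<Gamma> m(1)] by fastforce
  also have "card \<dots> = (\<Sum>A\<in>neg_class m' ` \<Gamma>. card (coset_children \<Gamma> m A))"
  proof (intro card_UN_disjoint ballI impI)
    fix A assume "A \<in> neg_class m' ` \<Gamma>"
    show "finite (coset_children \<Gamma> m A)"
      by (rule finite_subset[OF coset_children_subset[OF \<Gamma>] finite_neg_class_image[OF m(2)]])
  next
    fix A B assume AB: "A \<in> neg_class m' ` \<Gamma>" "B \<in> neg_class m' ` \<Gamma>" "A \<noteq> B"
    show "coset_children \<Gamma> m A \<inter> coset_children \<Gamma> m B = {}"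
    proof (rule ccontr)
      assume "coset_children \<Gamma> m A \<inter> coset_children \<Gamma> m B \<noteq> {}"
      then obtain C where C: "C \<in> coset_children \<Gamma> m A" "C \<in> coset_children \<Gamma> m B" by blast
      then obtain z where "z \<in> \<Gamma>" "C = neg_class m z" using coset_children_subset[OF \<Gamma>] by blast
      then show False using neg_class_mem_children_iff[OF \<Gamma> m(1)] AB C by metis
    qed
  qed (use finite_neg_class_image[OF m'] in auto)
  also have "\<dots> = (\<Sum>A\<in>neg_class m' ` \<Gamma>. card (coset_children \<Gamma> m (neg_class m' 0)))"
    by (intro sum.cong refl card_coset_children[OF \<Gamma> m(1)])
  finally show ?thesis by simp
qed

lemma (in prob_space) AE_mem_finite:
  assumes S: "finite S" and meas: "\<And>s. s \<in> S \<Longrightarrow> {w \<in> space M. X w = s} \<in> events"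
    and total: "(\<Sum>s\<in>S. prob {w \<in> space M. X w = s}) = 1"
  shows "AE w in M. X w \<in> S"
proof -
  have "prob (\<Union>s\<in>S. {w \<in> space M. X w = s}) = 1"
    using assms by (subst finite_measure_finite_Union) (auto simp: disjoint_family_on_def)
  moreover have "(\<Union>s\<in>S. {w \<in> space M. X w = s}) \<in> events" using S meas by auto
  ultimately have "AE w in M. w \<in> (\<Union>s\<in>S. {w \<in> space M. X w = s})" by (simp add: prob_eq_1)
  then show ?thesis by eventually_elim auto
qed

text \<open>
  A uniform parent followed by a uniform child is a uniform child, since the children of distinct
  parents are disjoint and equally numerous.
\<close>

lemma chain_marginal:
  fixes \<Gamma> :: "(int ^ 'd) set"
  assumes \<Gamma>: "add_subgroup \<Gamma>" and p: "p > 0" and C: "C \<in> neg_class (p ^ k) ` \<Gamma>"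
  shows "measure (coset_chain_law \<Gamma> p) {w. w k = C} = 1 / card (neg_class (p ^ k) ` \<Gamma>)"
  using C
proof (induction k arbitrary: C)
  case 0
  have "neg_class (p ^ 0) y = UNIV" for y :: "int ^ 'd" by (simp add: neg_class_def)
  then have "neg_class (p ^ 0) ` \<Gamma> = {UNIV}" using \<Gamma> by (auto simp: add_subgroup_def)
  then show ?case using 0 chain_start[of \<Gamma> p] by (simp add: measure_def)
next
  case (Suc k)
  interpret L: prob_space "coset_chain_law \<Gamma> p" by (rule prob_space_coset_chain_law)
  let ?S = "neg_class (p ^ k) ` \<Gamma>" and ?m = "p ^ Suc k"
  let ?b = "card (coset_children \<Gamma> ?m (neg_class (p ^ k) 0))"
  have fin: "finite ?S" "finite (neg_class ?m ` \<Gamma>)" using p by (intro finite_neg_class_image; simp)+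
  have ne: "?S \<noteq> {}" "neg_class ?m ` \<Gamma> \<noteq> {}" using \<Gamma> by (auto simp: add_subgroup_def)
  have dvd: "p ^ k dvd ?m" by simp
  have card_eq: "card (neg_class ?m ` \<Gamma>) = card ?S * ?b"
    using p by (intro card_neg_class_children[OF \<Gamma> dvd]) simp
  obtain z where z: "z \<in> \<Gamma>" "C = neg_class ?m z" using Suc.prems by auto
  \<comment> \<open>The induction hypothesis gives total mass one to the classes meeting \<open>\<Gamma>\<close>.\<close>
  have inS: "AE w in coset_chain_law \<Gamma> p. w k \<in> ?S"
    by (rule L.AE_mem_finite[OF fin(1)]) (use Suc.IH ne fin in \<open>auto intro: sets_chain_Collect\<close>)
  have "measure (coset_chain_law \<Gamma> p) {w. w (Suc k) = C}
      = measure (coset_chain_law \<Gamma> p) (\<Union>A\<in>?S. {w. w k = A \<and> w (Suc k) = C})"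
  proof (rule L.finite_measure_eq_AE)
    show "AE w in coset_chain_law \<Gamma> p. (w \<in> {w. w (Suc k) = C}) = (w \<in> (\<Union>A\<in>?S. {w. w k = A \<and> w (Suc k) = C}))"
      using inS by eventually_elim auto
    show "(\<Union>A\<in>?S. {w. w k = A \<and> w (Suc k) = C}) \<in> sets (coset_chain_law \<Gamma> p)"
      using fin(1) by (intro sets.finite_UN sets_chain_Collect) measurable
  qed (intro sets_chain_Collect, measurable)
  also have "\<dots> = (\<Sum>A\<in>?S. measure (coset_chain_law \<Gamma> p) {w. w k = A \<and> w (Suc k) = C})"
    using fin(1) by (intro L.finite_measure_finite_Union)
      (auto simp: disjoint_family_on_def intro!: sets_chain_Collect)
  also have "\<dots> = (\<Sum>A\<in>?S. if A = neg_class (p ^ k) z then 1 / real (card ?S * ?b) else 0)"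
  proof (intro sum.cong refl)
    fix A assume A: "A \<in> ?S"
    have fc: "finite (coset_children \<Gamma> ?m A)"
      by (rule finite_subset[OF coset_children_subset[OF \<Gamma>] fin(2)])
    have cb: "card (coset_children \<Gamma> ?m A) = ?b" by (rule card_coset_children[OF \<Gamma> dvd A])
    have "card (neg_class ?m ` \<Gamma>) > 0" using fin(2) ne(2) by (simp add: card_gt_0_iff)
    then have "?b > 0" using card_eq by (metis gr0I mult_0_right less_irrefl)
    then have nc: "coset_children \<Gamma> ?m A \<noteq> {}" using cb by auto
    have "measure (coset_chain_law \<Gamma> p) {w. w k = A \<and> w (Suc k) = C}
       = measure (coset_chain_law \<Gamma> p) {w. w k = A} * pmf (pmf_of_set (coset_children \<Gamma> ?m A)) C"
      using chain_joint[of \<Gamma> p k A C] by (simp add: measure_def enn2real_mult)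
    also have "pmf (pmf_of_set (coset_children \<Gamma> ?m A)) C = indicator (coset_children \<Gamma> ?m A) C / ?b"
      using pmf_of_set[OF nc fc] cb by simp
    also have "measure (coset_chain_law \<Gamma> p) {w. w k = A} = 1 / card ?S" by (rule Suc.IH[OF A])
    finally show "measure (coset_chain_law \<Gamma> p) {w. w k = A \<and> w (Suc k) = C}
        = (if A = neg_class (p ^ k) z then 1 / real (card ?S * ?b) else 0)"
      using neg_class_mem_children_iff[OF \<Gamma> dvd z(1) A] z(2) by (simp add: indicator_def)
  qed
  also have "\<dots> = 1 / real (card ?S * ?b)" using fin(1) z(1) by simp
  finally show ?case by (simp only: card_eq)
qed

text \<open>The almost sure properties of the chain; the later arguments about the chain are deterministic under them.\<close>

definition nested_classes :: "(int ^ 'd) set \<Rightarrow> nat \<Rightarrow> (nat \<Rightarrow> (int ^ 'd) set) \<Rightarrow> bool" where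
  "nested_classes \<Gamma> p w \<longleftrightarrow> (\<forall>k. w k \<in> neg_class (p ^ k) ` \<Gamma> \<and> w (Suc k) \<subseteq> w k)"

lemma AE_chain_nested:
  fixes \<Gamma> :: "(int ^ 'd) set"
  assumes \<Gamma>: "add_subgroup \<Gamma>" and p: "p > 0"
  shows "AE w in coset_chain_law \<Gamma> p. nested_classes \<Gamma> p w"
  unfolding nested_classes_def AE_all_countable
proof
  fix k
  interpret L: prob_space "coset_chain_law \<Gamma> p" by (rule prob_space_coset_chain_law)
  have fin: "finite (neg_class (p ^ j) ` \<Gamma>)" for j using p by (intro finite_neg_class_image) simp
  have ne: "neg_class (p ^ j) ` \<Gamma> \<noteq> {}" for j using \<Gamma> by (auto simp: add_subgroup_def)
  have mem: "AE w in coset_chain_law \<Gamma> p. w j \<in> neg_class (p ^ j) ` \<Gamma>" for j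
    by (rule L.AE_mem_finite[OF fin]) (use chain_marginal[OF \<Gamma> p] ne fin in \<open>auto intro: sets_chain_Collect\<close>)
  have "AE w in coset_chain_law \<Gamma> p. \<forall>A\<in>neg_class (p ^ k) ` \<Gamma>. \<forall>C\<in>neg_class (p ^ Suc k) ` \<Gamma>.
      \<not> C \<subseteq> A \<longrightarrow> \<not> (w k = A \<and> w (Suc k) = C)"
  proof (intro AE_finite_allI fin)
    fix A C assume AC: "A \<in> neg_class (p ^ k) ` \<Gamma>" "C \<in> neg_class (p ^ Suc k) ` \<Gamma>"
    show "AE w in coset_chain_law \<Gamma> p. \<not> C \<subseteq> A \<longrightarrow> \<not> (w k = A \<and> w (Suc k) = C)"
    proof (cases "C \<subseteq> A")
      case False
      have "card (coset_children \<Gamma> (p ^ Suc k) A) > 0"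
      proof -
        have "card (neg_class (p ^ Suc k) ` \<Gamma>) > 0" using fin[of "Suc k"] ne[of "Suc k"] by (metis card_gt_0_iff)
        then show ?thesis
          using card_neg_class_children[OF \<Gamma>, of "p ^ k" "p ^ Suc k"] card_coset_children[OF \<Gamma> _ AC(1), of "p ^ Suc k"] p
          by (metis dvd_triv_right gr0I less_irrefl mult_0_right power_Suc zero_less_power)
      qed
      then have "pmf (pmf_of_set (coset_children \<Gamma> (p ^ Suc k) A)) C = 0"
        using False by (subst pmf_of_set) (auto simp: card_gt_0_iff coset_children_def)
      then have "emeasure (coset_chain_law \<Gamma> p) {w. w k = A \<and> w (Suc k) = C} = 0"
        by (simp add: chain_joint)
      then have "AE w in coset_chain_law \<Gamma> p. w \<notin> {w. w k = A \<and> w (Suc k) = C}"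
        by (intro AE_not_in) (auto simp: null_sets_def intro!: sets_chain_Collect)
      then show ?thesis by eventually_elim auto
    qed simp
  qed
  then show "AE w in coset_chain_law \<Gamma> p. w k \<in> neg_class (p ^ k) ` \<Gamma> \<and> w (Suc k) \<subseteq> w k"
    using mem[of k] mem[of "Suc k"] by eventually_elim blast
qed

lemma nested_classes_antimono:
  assumes "nested_classes \<Gamma> p w" "k \<le> n" shows "w n \<subseteq> w k"
  using assms(2)
proof (induction n rule: dec_induct)
  case (step n)
  then show ?case using assms(1) by (auto simp: nested_classes_def)
qed simp

text \<open>
  The coset at level \<open>n\<close> determines the cosets at all lower levels, so a nested chain agrees up
  to level \<open>n\<close> with the divisibility pattern of translates by a single vector \<open>y\<close>.
\<close>

lemma nested_classes_mem_iff:
  assumes w: "nested_classes \<Gamma> p w" "k \<le> n" and y: "w n = neg_class (p ^ n) y"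
  shows "x \<in> w k \<longleftrightarrow> p ^ k dvd vgcd (x + y)"
proof -
  have "w k \<in> neg_class (p ^ k) ` \<Gamma>" using w(1) by (simp add: nested_classes_def)
  then obtain z where z: "w k = neg_class (p ^ k) z" by blast
  have "p ^ k dvd vgcd (y - z)"
    using nested_classes_antimono[OF w] neg_class_subset_iff[of "p ^ k" "p ^ n" y z] w(2)
    by (simp add: y z le_imp_power_dvd)
  then have "w k = neg_class (p ^ k) y" using z neg_class_eq_iff[of "p ^ k" y z] by simp
  then show ?thesis by (simp add: neg_class_def)
qed

section \<open>Finitely many residues: Foelner averages and independent chains\<close>

abbreviation chains_law :: "(int ^ 'd) set \<Rightarrow> (nat \<Rightarrow> nat \<Rightarrow> (int ^ 'd) set) measure" where
  "chains_law \<Gamma> \<equiv> PiM {p. prime p} (coset_chain_law \<Gamma>)"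

lemma product_prob_space_chains: "product_prob_space (coset_chain_law \<Gamma>)"
  by (intro product_prob_spaceI prob_space_coset_chain_law)

lemma prob_space_chains_law: "prob_space (chains_law \<Gamma>)"
  by (intro prob_space_PiM prob_space_coset_chain_law)

lemma measurable_chains_component:
  "prime p \<Longrightarrow> (\<lambda>W. W p k) \<in> measurable (chains_law \<Gamma>) (count_space UNIV)"
  by (rule measurable_compose[OF measurable_component_singleton[of p] measurable_chain_component]) simp

lemma pred_chains_component [measurable]:
  "prime p \<Longrightarrow> Measurable.pred (chains_law \<Gamma>) (\<lambda>W. Q (W p k))"
  by (rule measurable_compose[OF measurable_chains_component]) auto

lemma AE_chains_nested:
  fixes \<Gamma> :: "(int ^ 'd) set"
  assumes \<Gamma>: "add_subgroup \<Gamma>"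
  shows "AE W in chains_law \<Gamma>. \<forall>p. prime p \<longrightarrow> nested_classes \<Gamma> p (W p)"
  unfolding AE_all_countable
proof
  fix p :: nat
  show "AE W in chains_law \<Gamma>. prime p \<longrightarrow> nested_classes \<Gamma> p (W p)"
  proof (cases "prime p")
    case True
    then have "AE W in chains_law \<Gamma>. nested_classes \<Gamma> p (W p)"
      by (intro AE_PiM_component prob_space_coset_chain_law AE_chain_nested[OF \<Gamma>] prime_gt_0_nat) auto
    then show ?thesis by simp
  qed simp
qed

lemma measure_chains_cylinder:
  assumes "finite P" "\<And>p. p \<in> P \<Longrightarrow> prime p"
  shows "measure (chains_law \<Gamma>) {W \<in> space (chains_law \<Gamma>). \<forall>p\<in>P. Q p (W p (e p))}
    = (\<Prod>p\<in>P. measure (coset_chain_law \<Gamma> p) {w. Q p (w (e p))})"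
proof -
  interpret product_prob_space "coset_chain_law \<Gamma>" "{p. prime p}" by (rule product_prob_space_chains)
  have "emeasure (chains_law \<Gamma>) {W \<in> space (chains_law \<Gamma>). \<forall>p\<in>P. W p \<in> {w. Q p (w (e p))}}
      = (\<Prod>p\<in>P. emeasure (coset_chain_law \<Gamma> p) {w. Q p (w (e p))})"
    using assms by (intro emeasure_PiM_Collect) (auto intro!: sets_chain_Collect)
  then show ?thesis
    by (simp add: emeasure_eq_measure M.emeasure_eq_measure prod_ennreal prod_nonneg)
qed

text \<open>
  The link between the two sides of the theorem. An observable \<open>\<phi>\<close> that depends on finitely many residues
  of \<open>y\<close> is averaged over \<open>F n\<close>, and \<open>\<Phi>\<close> is the same observable read off the chains. Both
  expectations are governed by the uniform law on the finite set \<open>T\<close> of tuples of classes: the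
  first by equidistribution, the second by independence and the uniform marginals.
\<close>

lemma finite_level_limit:
  fixes \<Gamma> :: "(int ^ 'd) set" and \<phi> :: "int ^ 'd \<Rightarrow> real"
  assumes F: "Folner_sequence \<Gamma> F" and \<Gamma>: "add_subgroup \<Gamma>"
    and P: "finite P" "\<And>p. p \<in> P \<Longrightarrow> prime p"
    and \<Phi>: "\<Phi> \<in> borel_measurable (chains_law \<Gamma>)"
    and eq: "\<And>W y. \<lbrakk>\<And>p. prime p \<Longrightarrow> nested_classes \<Gamma> p (W p); y \<in> \<Gamma>;
        \<And>p. p \<in> P \<Longrightarrow> W p (e p) = neg_class (p ^ e p) y\<rbrakk> \<Longrightarrow> \<Phi> W = \<phi> y"
    and dep: "\<And>y y'. \<lbrakk>y \<in> \<Gamma>; y' \<in> \<Gamma>; \<And>p. p \<in> P \<Longrightarrow> p ^ e p dvd vgcd (y - y')\<rbrakk> \<Longrightarrow> \<phi> y = \<phi> y'"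
  shows "(\<lambda>n. measure_pmf.expectation (pmf_of_set (F n)) \<phi>) \<longlonglongrightarrow> (\<integral>W. \<Phi> W \<partial>chains_law \<Gamma>)"
proof -
  interpret \<Pi>: prob_space "chains_law \<Gamma>" by (rule prob_space_chains_law)
  define c :: "int ^ 'd \<Rightarrow> nat \<Rightarrow> (int ^ 'd) set" where "c = (\<lambda>y. \<lambda>p\<in>P. neg_class (p ^ e p) y)"
  define T where "T = c ` \<Gamma>"
  have p0: "p ^ e p > 0" if "p \<in> P" for p using P(2)[OF that] prime_gt_0_nat by simp
  have T_eq: "T = PiE P (\<lambda>p. neg_class (p ^ e p) ` \<Gamma>)"
    unfolding T_def c_def using P
    by (intro neg_class_tuples \<Gamma>) (auto simp: primes_coprime)
  have finT: "finite T" unfolding T_eq using P p0 by (intro finite_PiE finite_neg_class_image) auto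
  have c_iff: "c y = c y' \<longleftrightarrow> (\<forall>p\<in>P. p ^ e p dvd vgcd (y - y'))" for y y'
    by (auto simp: c_def fun_eq_iff restrict_def neg_class_eq_iff)
  \<comment> \<open>The observable as a function on tuples; by \<open>dep\<close> the choice of the representative is immaterial.\<close>
  define \<psi> where "\<psi> t = \<phi> (SOME y. y \<in> \<Gamma> \<and> c y = t)" for t
  have \<psi>: "\<phi> y = \<psi> (c y)" if "y \<in> \<Gamma>" for y
  proof -
    have "(SOME z. z \<in> \<Gamma> \<and> c z = c y) \<in> \<Gamma> \<and> c (SOME z. z \<in> \<Gamma> \<and> c z = c y) = c y"
      by (rule someI) (use that in simp)
    then show ?thesis unfolding \<psi>_def using that by (intro dep) (auto simp: c_iff dvd_vgcd_iff dvd_diff_commute)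
  qed
  have lim: "(\<lambda>n. measure_pmf.expectation (pmf_of_set (F n)) \<phi>) \<longlonglongrightarrow> (\<Sum>t\<in>T. \<psi> t * (1 / card T))"
    unfolding T_def
  proof (rule Folner_expectation[OF F \<Gamma>])
    show "finite (c ` \<Gamma>)" using finT by (simp add: T_def)
  qed (auto simp: c_iff intro!: \<psi>)
  let ?E = "\<lambda>t. {W \<in> space (chains_law \<Gamma>). \<forall>p\<in>P. W p (e p) = t p}"
  have E_sets: "?E t \<in> sets (chains_law \<Gamma>)" for t
    using P by (intro predE pred_intros_finite pred_chains_component) auto
  have E_meas: "measure (chains_law \<Gamma>) (?E t) = 1 / card T" if t: "t \<in> T" for t
  proof -
    have "measure (chains_law \<Gamma>) (?E t) = (\<Prod>p\<in>P. measure (coset_chain_law \<Gamma> p) {w. w (e p) = t p})"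
      using P by (rule measure_chains_cylinder)
    also have "\<dots> = (\<Prod>p\<in>P. 1 / card (neg_class (p ^ e p) ` \<Gamma>))"
      using t P prime_gt_0_nat by (intro prod.cong refl chain_marginal[OF \<Gamma>]) (auto simp: T_eq PiE_iff)
    also have "\<dots> = 1 / card T" using P by (simp add: T_eq card_PiE prod_dividef)
    finally show ?thesis .
  qed
  have "(\<integral>W. \<Phi> W \<partial>chains_law \<Gamma>) = (\<integral>W. (\<Sum>t\<in>T. \<psi> t * indicator (?E t) W) \<partial>chains_law \<Gamma>)"
  proof (rule integral_cong_AE[OF \<Phi>])
    show "(\<lambda>W. \<Sum>t\<in>T. \<psi> t * indicator (?E t) W) \<in> borel_measurable (chains_law \<Gamma>)"
      using E_sets by (intro borel_measurable_sum borel_measurable_times borel_measurable_const borel_measurable_indicator) auto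
    show "AE W in chains_law \<Gamma>. \<Phi> W = (\<Sum>t\<in>T. \<psi> t * indicator (?E t) W)"
      using AE_chains_nested[OF \<Gamma>] AE_space
    proof eventually_elim
      case (elim W)
      define s where "s = (\<lambda>p\<in>P. W p (e p))"
      have "s \<in> T" using elim(1) P by (auto simp: s_def T_eq nested_classes_def)
      then obtain y where y: "y \<in> \<Gamma>" "s = c y" by (auto simp: T_def)
      have W_eq: "W p (e p) = neg_class (p ^ e p) y" if "p \<in> P" for p
        using fun_cong[OF y(2), of p] that by (simp add: s_def c_def)
      have "\<Phi> W = \<psi> s" using eq[of W y] elim(1) y W_eq \<psi> by auto
      moreover have "indicator (?E t) W = (if t = s then 1 else 0 :: real)" if "t \<in> T" for t
        using that elim(2) by (auto simp: T_eq s_def PiE_iff extensional_def fun_eq_iff indicator_def)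
      ultimately show ?case using finT \<open>s \<in> T\<close> by (simp add: if_distrib[of "\<lambda>x. _ * x"] cong: if_cong)
    qed
  qed
  also have "\<dots> = (\<Sum>t\<in>T. \<psi> t * measure (chains_law \<Gamma>) (?E t))"
    using E_sets by (subst Bochner_Integration.integral_sum) (auto simp: \<Pi>.emeasure_eq_measure)
  also have "\<dots> = (\<Sum>t\<in>T. \<psi> t * (1 / card T))" using E_meas by (intro sum.cong) auto
  finally show ?thesis using lim by simp
qed

section \<open>Continuous functions on products of the compactified naturals\<close>

text \<open>
  Equality up to the threshold \<open>K\<close>, above which all values including \<open>\<infinity>\<close> are identified. For varying
  \<open>K\<close> these equivalence relations have open classes and generate the topology.
\<close>

definition enat_near :: "nat \<Rightarrow> enat \<Rightarrow> enat \<Rightarrow> bool" where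
  "enat_near K a b \<longleftrightarrow> min a (enat K) = min b (enat K)"

lemma enat_near_iff: "enat_near K a b \<longleftrightarrow> a = b \<or> (enat K \<le> a \<and> enat K \<le> b)"
  by (auto simp: enat_near_def min_def)

lemma enat_near_mono:
  assumes "enat_near K a b" "K' \<le> K" shows "enat_near K' a b"
proof -
  have "min c (enat K') = min (min c (enat K)) (enat K')" for c
    using assms(2) by (simp add: min.assoc min_absorb2)
  then show ?thesis using assms(1) unfolding enat_near_def by metis
qed

lemma open_enat_near: "open {b. enat_near K a b}"
  unfolding open_enat_iff
proof
  assume "\<infinity> \<in> {b. enat_near K a b}"
  then have "enat K \<le> a" by (auto simp: enat_near_iff)
  then have "{enat K<..} \<subseteq> {b. enat_near K a b}" by (auto simp: enat_near_iff)
  then show "\<exists>n. {enat n<..} \<subseteq> {b. enat_near K a b}" by blast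
qed

lemma enat_near_nbhd:
  assumes "open U" "a \<in> U" obtains K where "{b. enat_near K a b} \<subseteq> U"
proof (cases a)
  case (enat n)
  have "{b. enat_near (Suc n) a b} \<subseteq> U" using assms(2) enat by (auto simp: enat_near_iff)
  then show ?thesis using that by blast
next
  case infinity
  then obtain n :: nat where n: "{enat n<..} \<subseteq> U" using assms by (auto simp: open_enat_iff)
  have "{b. enat_near (Suc n) a b} \<subseteq> U"
  proof
    fix b assume "b \<in> {b. enat_near (Suc n) a b}"
    then have "b = a \<or> enat (Suc n) \<le> b" by (auto simp: enat_near_iff)
    moreover have "enat n < enat (Suc n)" by simp
    ultimately show "b \<in> U" using n assms(2) by (meson greaterThan_iff less_le_trans subsetD)
  qed
  then show ?thesis using that by blast
qed

text \<open>
  Around each configuration \<open>a\<close> the function varies by less than \<open>e / 2\<close> on a set \<open>N a A K\<close> given by finitely many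
  coordinates \<open>A\<close> and a threshold \<open>K\<close>. Finitely many of these sets cover the compact product.
  Joining their coordinates and thresholds refines all of them, so two configurations
  that agree in the joint sense lie in a common set of the cover.
\<close>

lemma continuous_map_finite_dependence:
  fixes f :: "('i \<Rightarrow> enat) \<Rightarrow> real"
  assumes f: "continuous_map (product_topology (\<lambda>_. euclidean) V) euclideanreal f" and e: "e > 0"
  obtains A K where "finite A" "A \<subseteq> V"
    "\<And>a b. \<lbrakk>a \<in> extensional V; b \<in> extensional V; \<forall>x\<in>A. enat_near K (a x) (b x)\<rbrakk> \<Longrightarrow> \<bar>f a - f b\<bar> < e"
proof -
  let ?X = "product_topology (\<lambda>_. euclidean :: enat topology) V"
  have top: "topspace ?X = extensional V" by (auto simp: PiE_def)
  define N where "N a A K = {b \<in> extensional V. \<forall>x\<in>A. enat_near K (a x) (b x)}" for a :: "'i \<Rightarrow> enat" and A K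
  have open_N: "openin ?X (N a A K)" if A: "finite A" "A \<subseteq> V" for a A K
  proof -
    have "N a A K = PiE V (\<lambda>x. if x \<in> A then {b. enat_near K (a x) b} else UNIV)"
      using A by (auto simp: N_def PiE_iff extensional_def split: if_splits)
    moreover have "openin ?X \<dots>"
    proof (intro openin_PiE_gen[THEN iffD2] disjI2 conjI ballI)
      show "finite {i \<in> V. (if i \<in> A then {b. enat_near K (a i) b} else UNIV) \<noteq> topspace (euclidean :: enat topology)}"
        by (rule finite_subset[OF _ A(1)]) auto
    qed (auto simp: open_enat_near)
    ultimately show ?thesis by simp
  qed
  have local: "\<exists>A K. finite A \<and> A \<subseteq> V \<and> (\<forall>b\<in>N a A K. \<bar>f b - f a\<bar> < e / 2)" if a: "a \<in> extensional V" for a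
  proof -
    let ?U = "{b \<in> topspace ?X. f b \<in> {f a - e / 2 <..< f a + e / 2}}"
    have "openin ?X ?U" by (rule openin_continuous_map_preimage[OF f]) simp
    moreover have "a \<in> ?U" using a e top by simp
    ultimately obtain B where B: "a \<in> (\<Pi>\<^sub>E i\<in>V. B i)" "\<And>i. open (B i)" "finite {i. B i \<noteq> UNIV}" "(\<Pi>\<^sub>E i\<in>V. B i) \<subseteq> ?U"
      using product_topology_open_contains_basis[of "\<lambda>_. euclidean" V ?U a] by auto
    define A where "A = {i. B i \<noteq> UNIV} \<inter> V"
    have "\<exists>K. {b. enat_near K (a x) b} \<subseteq> B x" if "x \<in> A" for x
    proof -
      have "a x \<in> B x" using B(1) that by (auto simp: A_def)
      then show ?thesis using enat_near_nbhd[OF B(2)[of x], of "a x"] by metis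
    qed
    then obtain k where k: "\<And>x. x \<in> A \<Longrightarrow> {b. enat_near (k x) (a x) b} \<subseteq> B x" by metis
    have fin: "finite A" using B(3) by (simp add: A_def)
    \<comment> \<open>Any common upper bound of the thresholds would do; the sum is a convenient one.\<close>
    define K where "K = sum k A"
    have kK: "k x \<le> K" if "x \<in> A" for x unfolding K_def using fin that by (intro member_le_sum) auto
    have "\<bar>f b - f a\<bar> < e / 2" if b: "b \<in> N a A K" for b
    proof -
      have "b x \<in> B x" if "x \<in> V" for x
      proof (cases "x \<in> A")
        case True
        then have "enat_near (k x) (a x) (b x)" using b kK by (auto simp: N_def intro: enat_near_mono)
        then show ?thesis using k[OF True] by blast
      next
        case False
        then show ?thesis using that by (auto simp: A_def)
      qed
      then have "b \<in> (\<Pi>\<^sub>E i\<in>V. B i)" using b by (auto simp: N_def PiE_iff)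
      then have "f b \<in> {f a - e / 2 <..< f a + e / 2}" using B(4) by blast
      then show ?thesis unfolding greaterThanLessThan_iff by linarith
    qed
    moreover have "A \<subseteq> V" by (simp add: A_def)
    ultimately show ?thesis using fin by blast
  qed
  obtain A K where AK: "\<And>a. a \<in> extensional V \<Longrightarrow> finite (A a) \<and> A a \<subseteq> V \<and> (\<forall>b\<in>N a (A a) (K a). \<bar>f b - f a\<bar> < e / 2)"
    using local by metis
  have "compact_space (euclidean :: enat topology)"
    by (simp add: compact_space_def compactin_euclidean_iff compact_UNIV)
  then have "compact_space ?X" unfolding compact_space_product_topology by simp
  then have "compactin ?X (extensional V)" using top by (simp add: compact_space_def)
  moreover have "\<And>U. U \<in> (\<lambda>a. N a (A a) (K a)) ` extensional V \<Longrightarrow> openin ?X U" using AK open_N by auto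
  moreover have "extensional V \<subseteq> \<Union> ((\<lambda>a. N a (A a) (K a)) ` extensional V)"
    by (force simp: N_def enat_near_def)
  ultimately have "\<exists>\<F>. finite \<F> \<and> \<F> \<subseteq> (\<lambda>a. N a (A a) (K a)) ` extensional V \<and> extensional V \<subseteq> \<Union>\<F>"
    by (rule compactinD)
  then obtain \<F> where \<F>: "finite \<F>" "\<F> \<subseteq> (\<lambda>a. N a (A a) (K a)) ` extensional V" "extensional V \<subseteq> \<Union>\<F>"
    by blast
  then obtain D where D: "D \<subseteq> extensional V" "finite D" "\<F> = (\<lambda>a. N a (A a) (K a)) ` D"
    using finite_subset_image[OF \<F>(1,2)] by auto
  show ?thesis
  proof (rule that[of "\<Union>(A ` D)" "sum K D"])
    show "finite (\<Union>(A ` D))" "\<Union>(A ` D) \<subseteq> V" using D AK by auto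
    fix a b assume ab: "a \<in> extensional V" "b \<in> extensional V" "\<forall>x\<in>\<Union>(A ` D). enat_near (sum K D) (a x) (b x)"
    obtain d where d: "d \<in> D" "a \<in> N d (A d) (K d)" using \<F>(3) D ab(1) by blast
    have le: "K d \<le> sum K D" using D(2) d(1) by (intro member_le_sum) auto
    have "enat_near (K d) (d x) (b x)" if "x \<in> A d" for x
    proof -
      have "enat_near (K d) (a x) (b x)" using ab(3) that d(1) le by (blast intro: enat_near_mono)
      moreover have "enat_near (K d) (d x) (a x)" using d(2) that by (simp add: N_def)
      ultimately show ?thesis by (simp add: enat_near_def)
    qed
    then have "b \<in> N d (A d) (K d)" using ab(2) by (simp add: N_def)
    then have "\<bar>f b - f d\<bar> < e / 2" "\<bar>f a - f d\<bar> < e / 2" using AK[of d] D d by auto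
    then show "\<bar>f a - f b\<bar> < e" by linarith
  qed
qed

section \<open>Truncated prime products\<close>

text \<open>
  The exponent counts the levels \<open>n \<le> M\<close> at which \<open>Q p\<close> holds. When \<open>Q p\<close> is downward closed, as for
  divisibility by \<open>p ^ n\<close> and for membership in a nested chain, this is the valuation cut off at \<open>M\<close>.
\<close>

definition truncated_product :: "nat \<Rightarrow> (nat \<Rightarrow> nat \<Rightarrow> bool) \<Rightarrow> nat" where
  "truncated_product M Q = (\<Prod>p | prime p \<and> p \<le> M. p ^ card {n \<in> {1..M}. Q p n})"

lemma truncated_product_cong:
  "(\<And>p n. prime p \<Longrightarrow> p \<le> M \<Longrightarrow> n \<le> M \<Longrightarrow> Q p n = Q' p n) \<Longrightarrow> truncated_product M Q = truncated_product M Q'"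
  unfolding truncated_product_def
  by (intro prod.cong refl arg_cong[where f = "(^) _"] arg_cong[where f = card]) auto

lemma truncated_product_ge_subproduct:
  assumes P: "finite P" "\<And>p. p \<in> P \<Longrightarrow> prime p \<and> p \<le> M"
  shows "(\<Prod>p\<in>P. p ^ card {n \<in> {1..M}. Q p n}) \<le> truncated_product M Q"
  unfolding truncated_product_def
proof (rule dvd_imp_le)
  show "(\<Prod>p\<in>P. p ^ card {n \<in> {1..M}. Q p n}) dvd (\<Prod>p | prime p \<and> p \<le> M. p ^ card {n \<in> {1..M}. Q p n})"
    using P by (intro prod_dvd_prod_subset) auto
  show "0 < (\<Prod>p | prime p \<and> p \<le> M. p ^ card {n \<in> {1..M}. Q p n})"
    by (intro prod_pos) (auto simp: prime_gt_0_nat)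
qed

lemma truncated_product_mono:
  assumes "M \<le> M'" shows "truncated_product M Q \<le> truncated_product M' Q"
proof -
  have "truncated_product M Q \<le> (\<Prod>p | prime p \<and> p \<le> M. p ^ card {n \<in> {1..M'}. Q p n})"
    unfolding truncated_product_def using assms prime_gt_0_nat
    by (intro prod_mono) (auto intro!: power_increasing card_mono simp: Suc_le_eq)
  also have "\<dots> \<le> truncated_product M' Q"
    using assms by (intro truncated_product_ge_subproduct) auto
  finally show ?thesis .
qed

lemma truncated_product_ge_prime:
  assumes "prime q" "q \<le> M" "Q q 1" shows "q \<le> truncated_product M Q"
proof -
  have q: "q \<ge> 2" using assms prime_ge_2_nat by simp
  then have "1 \<in> {n \<in> {1..M}. Q q n}" using assms by auto
  then have "card {n \<in> {1..M}. Q q n} > 0" by (auto simp: card_gt_0_iff)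
  then have "q ^ 1 \<le> q ^ card {n \<in> {1..M}. Q q n}" using q by (intro power_increasing) auto
  also have "\<dots> \<le> truncated_product M Q"
    using truncated_product_ge_subproduct[of "{q}" M Q] assms by simp
  finally show ?thesis by simp
qed

text \<open>No cut-off takes effect, since the prime factors of \<open>m\<close> and their multiplicities are at most \<open>m \<le> M\<close>.\<close>

lemma truncated_product_dvd_eq:
  assumes "1 \<le> m" "m \<le> M" shows "truncated_product M (\<lambda>p n. p ^ n dvd m) = m"
proof -
  have card: "card {n \<in> {1..M}. p ^ n dvd m} = multiplicity p m" if p: "prime p" for p
  proof -
    have "multiplicity p m < p ^ multiplicity p m" using prime_gt_1_nat[OF p] by (intro power_gt_expt) simp
    also have "\<dots> \<le> m" using assms by (intro dvd_imp_le multiplicity_dvd) auto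
    finally have le: "multiplicity p m \<le> M" using assms by simp
    have iff: "p ^ n dvd m \<longleftrightarrow> n \<le> multiplicity p m" for n
      using assms prime_gt_1_nat[OF p] by (intro power_dvd_iff_le_multiplicity) auto
    have "{n \<in> {1..M}. p ^ n dvd m} = {n \<in> {1..M}. n \<le> multiplicity p m}" by (simp only: iff)
    also have "\<dots> = {1..multiplicity p m}" using le by auto
    finally show ?thesis by simp
  qed
  have "truncated_product M (\<lambda>p n. p ^ n dvd m) = (\<Prod>p | prime p \<and> p \<le> M. p ^ multiplicity p m)"
    unfolding truncated_product_def using card by (intro prod.cong) auto
  also have "\<dots> = (\<Prod>p\<in>prime_factors m. p ^ multiplicity p m)"
    using assms by (intro prod.mono_neutral_right)
      (auto simp: in_prime_factors_iff not_dvd_imp_multiplicity_0 intro: order_trans[OF dvd_imp_le])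
  also have "\<dots> = m" using assms by (intro prime_factorization_nat[symmetric]) simp
  finally show ?thesis .
qed

lemma valuation_ge_iff:
  assumes w: "nested_classes \<Gamma> p w" shows "x \<in> w n \<longleftrightarrow> enat n \<le> valuation w x"
proof
  assume "x \<in> w n" then show "enat n \<le> valuation w x" unfolding valuation_def by (intro SUP_upper) simp
next
  assume *: "enat n \<le> valuation w x"
  show "x \<in> w n"
  proof (cases n)
    case 0
    have "w 0 \<in> neg_class (p ^ 0) ` \<Gamma>" using w unfolding nested_classes_def by blast
    then show ?thesis using 0 by (auto simp: neg_class_def)
  next
    case (Suc j)
    then have "enat j < valuation w x" using * by (metis enat_ord_simps(2) lessI less_le_trans)
    then obtain i where "x \<in> w i" "enat j < enat i" unfolding valuation_def by (auto simp: less_SUP_iff)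
    then show ?thesis using nested_classes_antimono[OF w, of n i] Suc by auto
  qed
qed

lemma card_levels:
  "enat (card {n \<in> {1..M}. enat n \<le> v}) \<le> v"
  "\<infinity> = v \<Longrightarrow> card {n \<in> {1..M}. enat n \<le> v} = M"
  "v = enat k \<Longrightarrow> k \<le> M \<Longrightarrow> card {n \<in> {1..M}. enat n \<le> v} = k"
proof -
  show "enat (card {n \<in> {1..M}. enat n \<le> v}) \<le> v"
  proof (cases v)
    case (enat k)
    have "card {n \<in> {1..M}. enat n \<le> v} \<le> card {1..k}" using enat by (intro card_mono) auto
    then show ?thesis using enat by simp
  qed simp
  show "card {n \<in> {1..M}. enat n \<le> v} = M" if "\<infinity> = v"
  proof -
    have "{n \<in> {1..M}. enat n \<le> v} = {1..M}" using that by auto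
    then show ?thesis by simp
  qed
  show "card {n \<in> {1..M}. enat n \<le> v} = k" if "v = enat k" "k \<le> M"
  proof -
    have "{n \<in> {1..M}. enat n \<le> v} = {1..k}" using that by auto
    then show ?thesis by simp
  qed
qed

lemma enat_prod: "enat (\<Prod>p\<in>P. f p) = (\<Prod>p\<in>P. enat (f p))"
  by (induction P rule: infinite_finite_induct) (simp_all add: one_enat_def flip: times_enat_simps(1))

lemma enat_prod_mono:
  fixes f g :: "'a \<Rightarrow> enat"
  assumes "\<And>p. p \<in> P \<Longrightarrow> f p \<le> g p" shows "prod f P \<le> prod g P"
  using assms by (induction P rule: infinite_finite_induct) (auto intro: mult_mono)

text \<open>
  The truncations increase, so it suffices to compute their supremum. A finite subproduct of
  the limit is reached by a truncation if all its valuations are finite. If one of them is infinite, the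
  truncations contain arbitrarily high powers of that prime. The hypothesis on \<open>q\<close> excludes the
  exceptional value \<open>0\<close> of the product.
\<close>

lemma truncated_product_tendsto:
  assumes w: "\<And>p. prime p \<Longrightarrow> nested_classes \<Gamma> p (W p)" and x: "x \<notin> W q m" "prime q"
  shows "(\<lambda>M. enat (truncated_product M (\<lambda>p n. x \<in> W p n))) \<longlonglongrightarrow> prime_product (\<lambda>p. valuation (W p) x)"
proof -
  let ?X = "\<lambda>M. enat (truncated_product M (\<lambda>p n. x \<in> W p n))"
  define v where "v p = valuation (W p) x" for p
  have iff: "x \<in> W p n \<longleftrightarrow> enat n \<le> v p" if "prime p" for p n
    using valuation_ge_iff[OF w[OF that]] by (simp add: v_def)
  have X_eq: "?X M = (\<Prod>p | prime p \<and> p \<le> M. enat (p ^ card {n \<in> {1..M}. enat n \<le> v p}))" for M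
    unfolding truncated_product_def enat_prod by (intro prod.cong refl) (simp add: iff)
  have "v q \<noteq> \<infinity>" using x(1) iff[OF x(2), of m] by (metis enat_ord_code(3))
  then have pp: "prime_product v = (SUP P\<in>{P. finite P \<and> (\<forall>p\<in>P. prime p)}. \<Prod>p\<in>P. enat_pow p (v p))"
    using x(2) by (auto simp: prime_product_def)
  have pow_le: "enat (p ^ card {n \<in> {1..M}. enat n \<le> v p}) \<le> enat_pow p (v p)" if "prime p" for p M
    using card_levels(1)[of M "v p"] prime_gt_0_nat[OF that]
    by (auto simp: enat_pow_def split: enat.splits intro!: power_increasing)
  have "(SUP M. ?X M) = prime_product v"
  proof (rule antisym)
    show "(SUP M. ?X M) \<le> prime_product v"
    proof (rule SUP_least)
      fix M
      have "?X M \<le> (\<Prod>p | prime p \<and> p \<le> M. enat_pow p (v p))"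
        unfolding X_eq by (intro enat_prod_mono pow_le) auto
      also have "\<dots> \<le> prime_product v" unfolding pp by (rule SUP_upper) auto
      finally show "?X M \<le> prime_product v" .
    qed
    show "prime_product v \<le> (SUP M. ?X M)" unfolding pp
    proof (rule SUP_least)
      fix P :: "nat set" assume "P \<in> {P. finite P \<and> (\<forall>p\<in>P. prime p)}"
      then have P: "finite P" "\<And>p. p \<in> P \<Longrightarrow> prime p" by auto
      show "(\<Prod>p\<in>P. enat_pow p (v p)) \<le> (SUP M. ?X M)"
      proof (cases "\<exists>r\<in>P. v r = \<infinity>")
        case True
        then obtain r where r: "r \<in> P" "v r = \<infinity>" by blast
        have "enat k \<le> (SUP M. ?X M)" for k
        proof -
          let ?M = "max k r"
          have r2: "prime r" using r P by simp
          have "k \<le> ?M" by simp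
          also have "?M \<le> r ^ ?M" using prime_gt_1_nat[OF r2] by (intro less_imp_le power_gt_expt) simp
          also have "\<dots> = r ^ card {n \<in> {1..?M}. x \<in> W r n}" using card_levels(2)[of "v r" ?M] r r2 by (simp add: iff)
          also have "\<dots> \<le> truncated_product ?M (\<lambda>p n. x \<in> W p n)"
            using truncated_product_ge_subproduct[of "{r}" ?M] r2 by simp
          finally have "enat k \<le> ?X ?M" by simp
          also have "\<dots> \<le> (SUP M. ?X M)" by (rule SUP_upper) simp
          finally show ?thesis .
        qed
        then have "(SUP M. ?X M) = \<infinity>"
          by (cases "SUP M. ?X M") (auto dest: spec[of _ "Suc _"] simp: not_le[symmetric], metis Suc_n_not_le_n enat_ord_simps(1))
        then show ?thesis by simp
      next
        case False
        define k where "k p = the_enat (v p)" for p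
        have k: "v p = enat (k p)" if "p \<in> P" for p using False that by (auto simp: k_def)
        define M where "M = sum k P + sum (\<lambda>p. p) P"
        have M: "k p \<le> M" "p \<le> M" if "p \<in> P" for p
          using member_le_sum[of p P k] member_le_sum[of p P "\<lambda>p. p"] P(1) that by (auto simp: M_def)
        have "(\<Prod>p\<in>P. enat_pow p (v p)) = enat (\<Prod>p\<in>P. p ^ card {n \<in> {1..M}. x \<in> W p n})"
          unfolding enat_prod using k M P(2) card_levels(3)
          by (intro prod.cong refl) (simp add: iff enat_pow_def)
        also have "\<dots> \<le> ?X M" unfolding enat_ord_simps using P M by (intro truncated_product_ge_subproduct) auto
        also have "\<dots> \<le> (SUP M. ?X M)" by (rule SUP_upper) simp
        finally show ?thesis .
      qed
    qed
  qed
  moreover have "incseq ?X" by (auto simp: incseq_def intro: truncated_product_mono)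
  moreover have "v = (\<lambda>p. valuation (W p) x)" by (simp add: v_def fun_eq_iff)
  ultimately show ?thesis using LIMSEQ_SUP[of ?X] by simp
qed

section \<open>Measurability of the limit configuration\<close>

lemma borel_measurable_enat_iff:
  "f \<in> borel_measurable M \<longleftrightarrow> f \<in> measurable M (count_space (UNIV :: enat set))"
proof -
  have "sets (borel :: enat measure) = sets (count_space UNIV)"
    using sets_borel_eq_count_space[where 'a=enat] by simp
  then show ?thesis using measurable_cong_sets[of M M "borel :: enat measure" "count_space UNIV"] by simp
qed

lemma measurable_prod_countable:
  fixes f :: "'i \<Rightarrow> 'a \<Rightarrow> 'b::{countable, comm_monoid_mult}"
  assumes "\<And>i. i \<in> I \<Longrightarrow> f i \<in> measurable M (count_space UNIV)"
  shows "(\<lambda>x. \<Prod>i\<in>I. f i x) \<in> measurable M (count_space UNIV)"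
  using assms
proof (induction I rule: infinite_finite_induct)
  case (insert i I)
  have IH: "(\<lambda>x. \<Prod>i\<in>I. f i x) \<in> measurable M (count_space UNIV)"
    by (rule insert.IH) (rule insert.prems, simp)
  have "(\<lambda>x. c * (\<Prod>i\<in>I. f i x)) \<in> measurable M (count_space UNIV)" for c
    by (rule measurable_compose[OF IH]) simp
  then have "(\<lambda>x. f i x * (\<Prod>i\<in>I. f i x)) \<in> measurable M (count_space UNIV)"
    by (rule measurable_compose_countable) (rule insert.prems, simp)
  then show ?case using insert.hyps by simp
qed simp_all

lemma measurable_truncated_product:
  "(\<lambda>W. truncated_product M (\<lambda>p n. x \<in> W p n)) \<in> measurable (chains_law \<Gamma>) (count_space UNIV)"
  unfolding truncated_product_def
proof (rule measurable_prod_countable)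
  fix p assume "p \<in> {p. prime p \<and> p \<le> M}"
  then have p: "prime p" by simp
  have "(\<lambda>W. card {n \<in> {1..M}. x \<in> W p n}) \<in> measurable (chains_law \<Gamma>) (count_space UNIV)"
  proof (rule measurable_card)
    fix i
    have "Measurable.pred (chains_law \<Gamma>) (\<lambda>W. i \<in> {1..M} \<and> x \<in> W p i)"
      using p by (intro pred_intros_conj1' pred_chains_component)
    then show "{W \<in> space (chains_law \<Gamma>). i \<in> {n \<in> {1..M}. x \<in> W p n}} \<in> sets (chains_law \<Gamma>)"
      unfolding pred_def mem_Collect_eq .
  qed
  then show "(\<lambda>W. p ^ card {n \<in> {1..M}. x \<in> W p n}) \<in> measurable (chains_law \<Gamma>) (count_space UNIV)"
    by (rule measurable_compose) simp
qed

lemma measurable_valuation: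
  assumes "prime p"
  shows "(\<lambda>W. valuation (W p) x) \<in> borel_measurable (chains_law \<Gamma>)"
proof -
  have eq: "valuation w x = (SUP n. if x \<in> w n then enat n else 0)" for w
    unfolding valuation_def
  proof (rule antisym)
    show "(SUP n\<in>{n. x \<in> w n}. enat n) \<le> (SUP n. if x \<in> w n then enat n else 0)"
      by (intro SUP_mono) auto
    show "(SUP n. if x \<in> w n then enat n else 0) \<le> (SUP n\<in>{n. x \<in> w n}. enat n)"
      by (intro SUP_least) (auto intro: SUP_upper)
  qed
  show ?thesis unfolding eq
  proof (rule borel_measurable_SUP)
    fix n
    show "(\<lambda>W. if x \<in> W p n then enat n else 0) \<in> borel_measurable (chains_law \<Gamma>)"
      by (rule measurable_If) (simp_all add: pred_chains_component[OF assms, unfolded pred_def])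
  qed simp
qed

lemma measurable_prime_product:
  "(\<lambda>W. prime_product (\<lambda>p. valuation (W p) x)) \<in> borel_measurable (chains_law \<Gamma>)"
  unfolding prime_product_def
proof (rule measurable_If)
  have v: "(\<lambda>W. valuation (W p) x) \<in> measurable (chains_law \<Gamma>) (count_space UNIV)" if "prime p" for p
    using measurable_valuation[OF that] by (simp add: borel_measurable_enat_iff)
  have "Measurable.pred (chains_law \<Gamma>) (\<lambda>W. \<forall>p. prime p \<longrightarrow> valuation (W p) x = \<infinity>)"
  proof (rule pred_intros_countable)
    fix p :: nat
    show "Measurable.pred (chains_law \<Gamma>) (\<lambda>W. prime p \<longrightarrow> valuation (W p) x = \<infinity>)"
    proof (cases "prime p")
      case True
      then show ?thesis using measurable_compose[OF v[OF True], of "\<lambda>c. c = \<infinity>" "count_space UNIV"] by simp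
    qed simp
  qed
  then show "{W \<in> space (chains_law \<Gamma>). \<forall>p. prime p \<longrightarrow> valuation (W p) x = \<infinity>} \<in> sets (chains_law \<Gamma>)"
    unfolding pred_def .
  show "(\<lambda>W. SUP P\<in>{P. finite P \<and> (\<forall>p\<in>P. prime p)}. \<Prod>p\<in>P. enat_pow p (valuation (W p) x)) \<in> borel_measurable (chains_law \<Gamma>)"
  proof (rule borel_measurable_SUP)
    show "countable {P. finite P \<and> (\<forall>p\<in>P. prime (p::nat))}"
      by (rule countable_subset[OF _ countable_Collect_finite]) auto
    fix P :: "nat set" assume P: "P \<in> {P. finite P \<and> (\<forall>p\<in>P. prime p)}"
    show "(\<lambda>W. \<Prod>p\<in>P. enat_pow p (valuation (W p) x)) \<in> borel_measurable (chains_law \<Gamma>)"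
      unfolding borel_measurable_enat_iff
      using P by (intro measurable_prod_countable measurable_compose[OF v]) auto
  qed
qed simp

definition limit_config :: "(nat \<Rightarrow> nat \<Rightarrow> (int ^ 'd) set) \<Rightarrow> int ^ 'd \<Rightarrow> enat" where
  "limit_config W x = prime_product (\<lambda>p. valuation (W p) x)"

lemma measurable_limit_config: "limit_config \<in> borel_measurable (chains_law \<Gamma>)"
  by (intro measurable_coordinatewise_then_product) (simp add: limit_config_def measurable_prime_product)

lemma continuous_map_restrict_UNIV:
  "continuous_map (product_topology (\<lambda>_. T) UNIV) (product_topology (\<lambda>_. T) V) (\<lambda>\<omega>. restrict \<omega> V)"
  unfolding continuous_map_componentwise
proof (intro conjI ballI)
  fix k assume "k \<in> V"
  then have eq: "(\<lambda>\<omega>. restrict \<omega> V k) = (\<lambda>\<omega>. \<omega> k)" by simp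
  show "continuous_map (product_topology (\<lambda>_. T) UNIV) T (\<lambda>\<omega>. restrict \<omega> V k)"
    unfolding eq by (rule continuous_map_product_projection) simp
qed auto

lemma continuous_on_restrict_compose:
  fixes f :: "('i \<Rightarrow> 'a::topological_space) \<Rightarrow> real"
  assumes f: "continuous_map (product_topology (\<lambda>_. euclidean) V) euclideanreal f"
  shows "continuous_on UNIV (\<lambda>\<omega>. f (restrict \<omega> V))"
proof -
  have "continuous_map (product_topology (\<lambda>_. euclidean) UNIV) (product_topology (\<lambda>_. euclidean) V) (\<lambda>\<omega>::'i \<Rightarrow> 'a. restrict \<omega> V)"
    by (rule continuous_map_restrict_UNIV)
  then have "continuous_map euclidean euclideanreal (f \<circ> (\<lambda>\<omega>::'i \<Rightarrow> 'a. restrict \<omega> V))"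
    unfolding euclidean_product_topology by (rule continuous_map_compose[OF _ f])
  then show ?thesis by (simp add: o_def continuous_map_iff_continuous2)
qed

section \<open>Reduction to pointwise truncation errors\<close>

lemma integral_pushforward_on:
  fixes h :: "'a \<Rightarrow> 'i \<Rightarrow> enat"
  assumes h: "h \<in> borel_measurable M"
    and f: "continuous_map (product_topology (\<lambda>_. euclidean) V) euclideanreal f"
  shows "(\<integral>\<omega>. f \<omega> \<partial>pushforward_on V (distr M borel h)) = (\<integral>a. f (restrict (h a) V) \<partial>M)"
proof -
  let ?T = "product_topology (\<lambda>_. euclidean :: enat topology) V"
  have open_Pow: "{U. openin ?T U} \<subseteq> Pow (topspace ?T)" using openin_subset by blast
  have sets_T: "sets (borel_of ?T) = sigma_sets (topspace ?T) {U. openin ?T U}" and space_T: "space (borel_of ?T) = topspace ?T"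
    unfolding borel_of_def using open_Pow by (simp_all add: sets_measure_of space_measure_of del: topspace_product_topology)
  have restr: "(\<lambda>\<omega>::'i \<Rightarrow> enat. restrict \<omega> V) \<in> measurable borel (borel_of ?T)"
    unfolding borel_of_def
  proof (rule measurable_measure_of)
    show "{U. openin ?T U} \<subseteq> Pow (topspace ?T)" by (rule open_Pow)
    show "(\<lambda>\<omega>::'i \<Rightarrow> enat. restrict \<omega> V) \<in> space borel \<rightarrow> topspace ?T" by (auto simp: PiE_def)
    fix U assume U: "U \<in> {U. openin ?T U}"
    have "continuous_map (product_topology (\<lambda>_. euclidean) UNIV) ?T (\<lambda>\<omega>. restrict \<omega> V)"
      by (rule continuous_map_restrict_UNIV)
    then have "continuous_map euclidean ?T (\<lambda>\<omega>::'i \<Rightarrow> enat. restrict \<omega> V)" by (simp only: euclidean_product_topology)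
    then have "openin euclidean {\<omega> \<in> topspace euclidean. restrict \<omega> V \<in> U}"
      using U by (intro openin_continuous_map_preimage) auto
    then have "open ((\<lambda>\<omega>. restrict \<omega> V) -` U)" by (simp add: vimage_def)
    then show "(\<lambda>\<omega>. restrict \<omega> V) -` U \<inter> space borel \<in> sets borel" by simp
  qed
  have "f \<in> borel_measurable (borel_of ?T)"
  proof (rule borel_measurableI)
    fix S :: "real set" assume "open S"
    then have "openin ?T {x \<in> topspace ?T. f x \<in> S}" by (intro openin_continuous_map_preimage[OF f]) simp
    moreover have "f -` S \<inter> space (borel_of ?T) = {x \<in> topspace ?T. f x \<in> S}" by (auto simp: space_T)
    ultimately show "f -` S \<inter> space (borel_of ?T) \<in> sets (borel_of ?T)" unfolding sets_T by auto
  qed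
  then show ?thesis
    unfolding pushforward_on_def using restr h
    by (subst integral_distr) (auto simp: integral_distr intro: measurable_compose)
qed

text \<open>Only the class of \<open>x\<close> itself contains \<open>x\<close>, and it is among the possible values of the chain when \<open>x \<in> \<Gamma>\<close>.\<close>

lemma chain_mem_prob:
  fixes \<Gamma> :: "(int ^ 'd) set"
  assumes \<Gamma>: "add_subgroup \<Gamma>" and p: "p > 0"
  shows "measure (coset_chain_law \<Gamma> p) {w. x \<in> w k} \<le> 1 / card (neg_class (p ^ k) ` \<Gamma>)"
    and "x \<in> \<Gamma> \<Longrightarrow> measure (coset_chain_law \<Gamma> p) {w. x \<in> w k} = 1 / card (neg_class (p ^ k) ` \<Gamma>)"
proof -
  interpret L: prob_space "coset_chain_law \<Gamma> p" by (rule prob_space_coset_chain_law)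
  let ?C = "neg_class (p ^ k) (- x)"
  have AE: "AE w in coset_chain_law \<Gamma> p. x \<in> w k \<longleftrightarrow> w k = ?C \<and> ?C \<in> neg_class (p ^ k) ` \<Gamma>"
    using AE_chain_nested[OF \<Gamma> p]
  proof eventually_elim
    case (elim w)
    then have mem: "w k \<in> neg_class (p ^ k) ` \<Gamma>" by (simp add: nested_classes_def)
    then obtain y where y: "y \<in> \<Gamma>" "w k = neg_class (p ^ k) y" by auto
    have "x \<in> w k \<longleftrightarrow> p ^ k dvd vgcd (y - - x)" using y by (simp add: neg_class_def add.commute)
    also have "\<dots> \<longleftrightarrow> w k = ?C" unfolding y(2) neg_class_eq_iff ..
    finally show ?case using mem by auto
  qed
  have eq: "measure (coset_chain_law \<Gamma> p) {w. x \<in> w k}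
      = measure (coset_chain_law \<Gamma> p) {w. w k = ?C \<and> ?C \<in> neg_class (p ^ k) ` \<Gamma>}"
    by (rule L.finite_measure_eq_AE) (use AE in \<open>auto intro!: sets_chain_Collect\<close>)
  show "measure (coset_chain_law \<Gamma> p) {w. x \<in> w k} \<le> 1 / card (neg_class (p ^ k) ` \<Gamma>)"
    unfolding eq using chain_marginal[OF \<Gamma> p, of ?C k] by (cases "?C \<in> neg_class (p ^ k) ` \<Gamma>") auto
  show "measure (coset_chain_law \<Gamma> p) {w. x \<in> w k} = 1 / card (neg_class (p ^ k) ` \<Gamma>)" if "x \<in> \<Gamma>"
  proof -
    have "?C \<in> neg_class (p ^ k) ` \<Gamma>" using that \<Gamma> by (auto simp: add_subgroup_def)
    then show ?thesis unfolding eq using chain_marginal[OF \<Gamma> p, of ?C k] by simp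
  qed
qed

text \<open>The probability that the coset at level \<open>n\<close> contains \<open>x\<close> is at most the inverse of the number of classes, which tends to \<open>0\<close>.\<close>

lemma AE_chains_escape:
  fixes \<Gamma> :: "(int ^ 'd) set"
  assumes \<Gamma>: "add_subgroup \<Gamma>" and g: "g \<in> \<Gamma>" "g \<noteq> 0"
  shows "AE W in chains_law \<Gamma>. \<forall>x. \<exists>n. x \<notin> W 2 n"
  unfolding AE_all_countable
proof
  fix x :: "int ^ 'd"
  interpret L: prob_space "coset_chain_law \<Gamma> 2" by (rule prob_space_coset_chain_law)
  let ?E = "{w. \<forall>n. x \<in> w n}"
  have "(\<lambda>n. 1 / real (card (neg_class (2 ^ n) ` \<Gamma>))) \<longlonglongrightarrow> 0"
    by (intro real_tendsto_divide_at_top[OF tendsto_const] filterlim_compose[OF filterlim_real_sequentially]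
        card_neg_class_at_top[OF \<Gamma> g]) simp
  moreover have "measure (coset_chain_law \<Gamma> 2) ?E \<le> 1 / real (card (neg_class (2 ^ n) ` \<Gamma>))" for n
  proof -
    have "measure (coset_chain_law \<Gamma> 2) ?E \<le> measure (coset_chain_law \<Gamma> 2) {w. x \<in> w n}"
      by (intro L.finite_measure_mono sets_chain_Collect) auto
    also have "\<dots> \<le> 1 / real (card (neg_class (2 ^ n) ` \<Gamma>))"
      using chain_mem_prob(1)[OF \<Gamma>, of 2 x n] by simp
    finally show ?thesis .
  qed
  ultimately have "measure (coset_chain_law \<Gamma> 2) ?E \<le> 0" by (intro LIMSEQ_le_const) auto
  then have "emeasure (coset_chain_law \<Gamma> 2) ?E = 0"
    by (simp add: L.emeasure_eq_measure measure_le_0_iff)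
  then have "AE w in coset_chain_law \<Gamma> 2. w \<notin> ?E"
    by (intro AE_not_in) (auto simp: null_sets_def intro!: sets_chain_Collect)
  then have "AE w in coset_chain_law \<Gamma> 2. \<exists>n. x \<notin> w n" by eventually_elim auto
  then show "AE W in chains_law \<Gamma>. \<exists>n. x \<notin> W 2 n"
    by (intro AE_PiM_component[of _ _ 2] prob_space_coset_chain_law) auto
qed

definition truncated_gcd :: "nat \<Rightarrow> int ^ 'd \<Rightarrow> nat" where
  "truncated_gcd M x = truncated_product M (\<lambda>p n. p ^ n dvd vgcd x)"

definition truncated_config :: "nat \<Rightarrow> (nat \<Rightarrow> nat \<Rightarrow> (int ^ 'd) set) \<Rightarrow> int ^ 'd \<Rightarrow> enat" where
  "truncated_config M W x = enat (truncated_product M (\<lambda>p n. x \<in> W p n))"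

lemma measurable_truncated_config: "truncated_config M \<in> borel_measurable (chains_law \<Gamma>)"
  by (intro measurable_coordinatewise_then_product)
     (simp add: truncated_config_def borel_measurable_enat_iff measurable_compose[OF measurable_truncated_product])

lemma truncated_config_tendsto:
  fixes \<Gamma> :: "(int ^ 'd) set" and f :: "(int ^ 'd \<Rightarrow> enat) \<Rightarrow> real"
  assumes \<Gamma>: "add_subgroup \<Gamma>" and g: "g \<in> \<Gamma>" "g \<noteq> 0"
    and f: "continuous_on UNIV f" "\<And>\<omega>. \<bar>f \<omega>\<bar> \<le> B"
  shows "(\<lambda>M. \<integral>W. f (truncated_config M W) \<partial>chains_law \<Gamma>) \<longlonglongrightarrow> (\<integral>W. f (limit_config W) \<partial>chains_law \<Gamma>)"
proof (rule integral_dominated_convergence[where w = "\<lambda>_. B"])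
  interpret \<Pi>: prob_space "chains_law \<Gamma>" by (rule prob_space_chains_law)
  have fm: "f \<in> borel_measurable borel" using f(1) by (rule borel_measurable_continuous_onI)
  show "(\<lambda>W. f (limit_config W)) \<in> borel_measurable (chains_law \<Gamma>)"
    by (rule measurable_compose[OF measurable_limit_config fm])
  show "(\<lambda>W. f (truncated_config M W)) \<in> borel_measurable (chains_law \<Gamma>)" for M
    by (rule measurable_compose[OF measurable_truncated_config fm])
  show "integrable (chains_law \<Gamma>) (\<lambda>_. B)" by simp
  show "AE W in chains_law \<Gamma>. norm (f (truncated_config M W)) \<le> B" for M using f(2) by simp
  show "AE W in chains_law \<Gamma>. (\<lambda>M. f (truncated_config M W)) \<longlonglongrightarrow> f (limit_config W)"
    using AE_chains_nested[OF \<Gamma>] AE_chains_escape[OF \<Gamma> g]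
  proof eventually_elim
    case (elim W)
    have "(\<lambda>M. truncated_config M W) \<longlonglongrightarrow> limit_config W"
    proof -
      have "(\<lambda>M. truncated_config M W x) \<longlonglongrightarrow> limit_config W x" for x
      proof -
      obtain n where "x \<notin> W 2 n" using elim(2) by blast
      then show "(\<lambda>M. truncated_config M W x) \<longlonglongrightarrow> limit_config W x"
        unfolding truncated_config_def limit_config_def
        using elim(1) by (intro truncated_product_tendsto[of \<Gamma>]) auto
      qed
      then have "limitin (product_topology (\<lambda>_. euclidean) UNIV) (\<lambda>M. truncated_config M W) (limit_config W) sequentially"
        by (simp add: limitin_componentwise del: euclidean_product_topology)
      then show ?thesis by (simp add: euclidean_product_topology)
    qed
    then show ?case by (rule continuous_on_tendsto_compose[OF f(1)]) auto
  qed
qed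

lemma truncated_gcd_limit:
  fixes \<Gamma> :: "(int ^ 'd) set" and f :: "(int ^ 'd \<Rightarrow> enat) \<Rightarrow> real"
  assumes F: "Folner_sequence \<Gamma> F" and \<Gamma>: "add_subgroup \<Gamma>" and f: "f \<in> borel_measurable borel"
  shows "(\<lambda>n. measure_pmf.expectation (pmf_of_set (F n)) (\<lambda>y. f (\<lambda>x. enat (truncated_gcd M (x + y)))))
    \<longlonglongrightarrow> (\<integral>W. f (truncated_config M W) \<partial>chains_law \<Gamma>)"
proof (rule finite_level_limit[OF F \<Gamma>, where P = "{p. prime p \<and> p \<le> M}" and e = "\<lambda>_. M"])
  show "(\<lambda>W. f (truncated_config M W)) \<in> borel_measurable (chains_law \<Gamma>)"
    by (rule measurable_compose[OF measurable_truncated_config f])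
next
  fix W :: "nat \<Rightarrow> nat \<Rightarrow> (int ^ 'd) set" and y :: "int ^ 'd"
  assume W: "\<And>p. prime p \<Longrightarrow> nested_classes \<Gamma> p (W p)"
    and eq: "\<And>p. p \<in> {p. prime p \<and> p \<le> M} \<Longrightarrow> W p M = neg_class (p ^ M) y"
  have "truncated_config M W = (\<lambda>x. enat (truncated_gcd M (x + y)))"
    unfolding truncated_config_def truncated_gcd_def
    using nested_classes_mem_iff[OF W] eq by (intro ext arg_cong[where f = enat] truncated_product_cong) auto
  then show "f (truncated_config M W) = f (\<lambda>x. enat (truncated_gcd M (x + y)))" by simp
next
  fix y y' :: "int ^ 'd"
  assume *: "\<And>p. p \<in> {p. prime p \<and> p \<le> M} \<Longrightarrow> p ^ M dvd vgcd (y - y')"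
  have "truncated_gcd M (x + y) = truncated_gcd M (x + y')" for x
    unfolding truncated_gcd_def
  proof (rule truncated_product_cong)
    fix p n assume p: "prime p" "p \<le> M" "n \<le> M"
    have "p ^ n dvd vgcd (y - y')" using *[of p] p by (auto intro: power_le_dvd)
    then have "neg_class (p ^ n) y = neg_class (p ^ n) y'" by (simp add: neg_class_eq_iff)
    then have "x \<in> neg_class (p ^ n) y \<longleftrightarrow> x \<in> neg_class (p ^ n) y'" by simp
    then show "p ^ n dvd vgcd (x + y) \<longleftrightarrow> p ^ n dvd vgcd (x + y')" by (simp add: neg_class_def)
  qed
  then show "f (\<lambda>x. enat (truncated_gcd M (x + y))) = f (\<lambda>x. enat (truncated_gcd M (x + y')))" by simp
qed auto

text \<open>
  The truncation error at \<open>x\<close> is asymptotically negligible: first \<open>M\<close> is chosen large, then \<open>n\<close>. Errors above the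
  threshold \<open>K\<close> are not counted, which is essential in rank one, where the gcds escape to \<open>\<infinity>\<close>.
\<close>

definition uniformly_truncatable :: "(nat \<Rightarrow> (int ^ 'd) set) \<Rightarrow> int ^ 'd \<Rightarrow> bool" where
  "uniformly_truncatable F x \<longleftrightarrow> (\<forall>K. \<forall>e>0. \<forall>\<^sub>F M in sequentially. \<forall>\<^sub>F n in sequentially.
     measure_pmf.prob (pmf_of_set (F n))
       {y. \<not> enat_near K (gcd_inf (x + y)) (enat (truncated_gcd M (x + y)))} < e)"

text \<open>
  The expectation at \<open>F n\<close> is compared with the limit through the truncations at a suitable fixed level \<open>M\<close>: truncating at
  \<open>F n\<close> costs at most \<open>r / 2\<close>, passing to the truncated chains and removing their truncation less
  than \<open>r / 4\<close> each.
\<close>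

lemma convergence_criterion:
  fixes \<Gamma> V :: "(int ^ 'd) set" and f :: "(int ^ 'd \<Rightarrow> enat) \<Rightarrow> real"
  assumes F: "Folner_sequence \<Gamma> F" and \<Gamma>: "add_subgroup \<Gamma>" and g: "g \<in> \<Gamma>" "g \<noteq> 0"
    and f: "continuous_map (product_topology (\<lambda>_. euclidean) V) euclideanreal f"
    and bdd: "bounded (f ` extensional V)"
    and tail: "\<And>x. x \<in> V \<Longrightarrow> uniformly_truncatable F x"
  shows "(\<lambda>n. measure_pmf.expectation (pmf_of_set (F n)) (\<lambda>y. f (restrict (\<lambda>x. gcd_inf (x + y)) V)))
    \<longlonglongrightarrow> (\<integral>W. f (restrict (limit_config W) V) \<partial>chains_law \<Gamma>)"
proof (rule LIMSEQ_I)
  fix r :: real assume r: "r > 0"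
  define h where "h \<omega> = f (restrict \<omega> V)" for \<omega>
  have hc: "continuous_on UNIV h" unfolding h_def by (rule continuous_on_restrict_compose[OF f])
  obtain B where B: "B > 0" "\<And>\<omega>. \<omega> \<in> extensional V \<Longrightarrow> \<bar>f \<omega>\<bar> \<le> B"
    using bdd by (auto simp: bounded_pos)
  have hB: "\<bar>h \<omega>\<bar> \<le> B" for \<omega> unfolding h_def by (rule B(2)) simp
  obtain A K where A: "finite A" "A \<subseteq> V"
    and AK: "\<And>a b. \<lbrakk>a \<in> extensional V; b \<in> extensional V; \<forall>x\<in>A. enat_near K (a x) (b x)\<rbrakk> \<Longrightarrow> \<bar>f a - f b\<bar> < r / 4"
    using continuous_map_finite_dependence[OF f, of "r / 4"] r by auto
  \<comment> \<open>Each coordinate in \<open>A\<close> may fail with probability \<open>e\<close>, and a failure costs up to \<open>2 * B\<close>; the total is at most \<open>r / 4\<close>. Adding \<open>1\<close> covers the case of an empty \<open>A\<close>.\<close>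
  define e where "e = r / (8 * B * (card A + 1))"
  have e: "e > 0" using r B by (simp add: e_def)
  define bad where "bad M x = {y. \<not> enat_near K (gcd_inf (x + y)) (enat (truncated_gcd M (x + y)))}" for M and x :: "int ^ 'd"
  let ?E = "\<lambda>n. measure_pmf.expectation (pmf_of_set (F n)) (\<lambda>y. h (\<lambda>x. gcd_inf (x + y)))"
  let ?E' = "\<lambda>M n. measure_pmf.expectation (pmf_of_set (F n)) (\<lambda>y. h (\<lambda>x. enat (truncated_gcd M (x + y))))"
  let ?I = "\<integral>W. h (limit_config W) \<partial>chains_law \<Gamma>" and ?I' = "\<lambda>M. \<integral>W. h (truncated_config M W) \<partial>chains_law \<Gamma>"
  have int: "integrable (measure_pmf (pmf_of_set (F n))) (\<lambda>y. h (\<theta> y))" for n and \<theta> :: "int ^ 'd \<Rightarrow> _"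
    by (rule measure_pmf.integrable_const_bound[where B = B]) (use hB in auto)
  have close: "\<bar>?E n - ?E' M n\<bar> \<le> r / 4 + 2 * B * (\<Sum>x\<in>A. measure_pmf.prob (pmf_of_set (F n)) (bad M x))" for M n
  proof -
    have "\<bar>h (\<lambda>x. gcd_inf (x + y)) - h (\<lambda>x. enat (truncated_gcd M (x + y)))\<bar>
        \<le> r / 4 + 2 * B * (\<Sum>x\<in>A. indicator (bad M x) y)" for y
    proof (cases "\<exists>x\<in>A. y \<in> bad M x")
      case True
      then obtain x where x: "x \<in> A" "y \<in> bad M x" by blast
      have "(1::real) = indicator (bad M x) y" using x by simp
      also have "\<dots> \<le> (\<Sum>x\<in>A. indicator (bad M x) y)"
        using A(1) x(1) by (intro member_le_sum) auto
      finally have "2 * B \<le> 2 * B * (\<Sum>x\<in>A. indicator (bad M x) y)" using B(1) by simp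
      moreover have "\<bar>h (\<lambda>x. gcd_inf (x + y)) - h (\<lambda>x. enat (truncated_gcd M (x + y)))\<bar> \<le> 2 * B"
        using hB[of "\<lambda>x. gcd_inf (x + y)"] hB[of "\<lambda>x. enat (truncated_gcd M (x + y))"] by linarith
      ultimately show ?thesis using r by linarith
    next
      case False
      then have "\<bar>h (\<lambda>x. gcd_inf (x + y)) - h (\<lambda>x. enat (truncated_gcd M (x + y)))\<bar> < r / 4"
        unfolding h_def using A(2) by (intro AK) (auto simp: bad_def)
      moreover have "0 \<le> 2 * B * (\<Sum>x\<in>A. indicator (bad M x) y :: real)"
        using B(1) by (intro mult_nonneg_nonneg sum_nonneg) auto
      ultimately show ?thesis by linarith
    qed
    note pointwise = this
    have "\<bar>?E n - ?E' M n\<bar> = \<bar>measure_pmf.expectation (pmf_of_set (F n))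
        (\<lambda>y. h (\<lambda>x. gcd_inf (x + y)) - h (\<lambda>x. enat (truncated_gcd M (x + y))))\<bar>"
      by (subst Bochner_Integration.integral_diff[OF int int]) simp
    also have "\<dots> \<le> measure_pmf.expectation (pmf_of_set (F n))
        (\<lambda>y. \<bar>h (\<lambda>x. gcd_inf (x + y)) - h (\<lambda>x. enat (truncated_gcd M (x + y)))\<bar>)"
      by (rule integral_abs_bound)
    also have "\<dots> \<le> measure_pmf.expectation (pmf_of_set (F n)) (\<lambda>y. r / 4 + 2 * B * (\<Sum>x\<in>A. indicator (bad M x) y))"
      by (intro integral_mono integrable_abs Bochner_Integration.integrable_diff int pointwise Bochner_Integration.integrable_add
          integrable_mult_right Bochner_Integration.integrable_sum) (auto simp: measure_pmf.emeasure_eq_measure)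
    also have "\<dots> = r / 4 + 2 * B * (\<Sum>x\<in>A. measure_pmf.prob (pmf_of_set (F n)) (bad M x))"
      by (subst Bochner_Integration.integral_add) (auto simp: measure_pmf.emeasure_eq_measure measure_pmf.prob_space intro!: integrable_mult_right Bochner_Integration.integrable_sum)
    finally show ?thesis .
  qed
  have "\<forall>\<^sub>F M in sequentially. \<forall>x\<in>A. \<forall>\<^sub>F n in sequentially. measure_pmf.prob (pmf_of_set (F n)) (bad M x) < e"
    using A tail e unfolding uniformly_truncatable_def bad_def by (intro eventually_ball_finite) auto
  moreover have "\<forall>\<^sub>F M in sequentially. dist (?I' M) ?I < r / 4"
    using truncated_config_tendsto[OF \<Gamma> g hc hB] r by (intro tendstoD) auto
  ultimately have "\<forall>\<^sub>F M in sequentially. (\<forall>x\<in>A. \<forall>\<^sub>F n in sequentially. measure_pmf.prob (pmf_of_set (F n)) (bad M x) < e)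
      \<and> dist (?I' M) ?I < r / 4"
    by eventually_elim simp
  then obtain M where M: "\<And>x. x \<in> A \<Longrightarrow> \<forall>\<^sub>F n in sequentially. measure_pmf.prob (pmf_of_set (F n)) (bad M x) < e"
      "dist (?I' M) ?I < r / 4"
    using eventually_happens'[OF sequentially_bot] by blast
  have "\<forall>\<^sub>F n in sequentially. \<forall>x\<in>A. measure_pmf.prob (pmf_of_set (F n)) (bad M x) < e"
    using M(1) A(1) by (intro eventually_ball_finite) auto
  moreover have "\<forall>\<^sub>F n in sequentially. dist (?E' M n) (?I' M) < r / 4"
    using truncated_gcd_limit[OF F \<Gamma> borel_measurable_continuous_onI[OF hc], of M] r by (intro tendstoD) auto
  ultimately have "\<forall>\<^sub>F n in sequentially. norm (?E n - ?I) < r"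
  proof eventually_elim
    case (elim n)
    have "(\<Sum>x\<in>A. measure_pmf.prob (pmf_of_set (F n)) (bad M x)) \<le> (\<Sum>x\<in>A. e)"
      using elim(1) by (intro sum_mono) (auto intro: less_imp_le)
    also have "\<dots> = card A * e" by simp
    finally have "2 * B * (\<Sum>x\<in>A. measure_pmf.prob (pmf_of_set (F n)) (bad M x)) \<le> 2 * B * (card A * e)"
      using B(1) by simp
    also have "\<dots> \<le> 2 * B * ((card A + 1) * e)" using B(1) e by simp
    also have "\<dots> = r / 4" using B(1) by (simp add: e_def)
    finally have "\<bar>?E n - ?E' M n\<bar> \<le> r / 2" using close[of n M] by linarith
    moreover have "\<bar>?E' M n - ?I' M\<bar> < r / 4" "\<bar>?I' M - ?I\<bar> < r / 4"
      using elim(2) M(2) by (simp_all only: dist_real_def)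
    ultimately show ?case unfolding real_norm_def by linarith
  qed
  then show "\<exists>no. \<forall>n\<ge>no. norm (measure_pmf.expectation (pmf_of_set (F n)) (\<lambda>y. f (restrict (\<lambda>x. gcd_inf (x + y)) V))
      - (\<integral>W. f (restrict (limit_config W) V) \<partial>chains_law \<Gamma>)) < r"
    unfolding h_def eventually_sequentially .
qed

section \<open>An Euler product over the primes\<close>

text \<open>
  Every divisor \<open>d\<close> of \<open>N = M!\<close> satisfies \<open>totient d \<ge> d * c\<close>, where \<open>c\<close> is the product over the primes up to
  \<open>M\<close>. Summing over the divisors \<open>N div m\<close> with \<open>m \<le> M\<close>, and using that the totients of all divisors
  of \<open>N\<close> sum to \<open>N\<close>, gives \<open>N * c * harm M \<le> N\<close>.
\<close>

lemma prod_primes_harm_le: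
  "(\<Prod>p | prime p \<and> p \<le> M. 1 - 1 / real p) * harm M \<le> 1"
proof -
  define N where "N = (fact M :: nat)"
  define c where "c = (\<Prod>p | prime p \<and> p \<le> M. 1 - 1 / real p)"
  have N: "N > 0" by (simp add: N_def)
  have fac: "0 \<le> 1 - 1 / real p" "1 - 1 / real p \<le> 1" if "prime p" for p
    using prime_gt_0_nat[OF that] by (simp_all add: divide_le_eq_1)
  have pf: "prime_factors N = {p. prime p \<and> p \<le> M}"
    unfolding N_def prime_factors_fact using prime_ge_2_nat by auto
  have ge: "real d * c \<le> real (totient d)" if d: "d dvd N" for d
  proof -
    have sub: "prime_factors d \<subseteq> prime_factors N" using d N by (intro dvd_prime_factors) auto
    have "c = (\<Prod>p\<in>prime_factors N - prime_factors d. 1 - 1 / real p) * (\<Prod>p\<in>prime_factors d. 1 - 1 / real p)"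
      unfolding c_def pf[symmetric] using sub by (intro prod.subset_diff) auto
    also have "\<dots> \<le> 1 * (\<Prod>p\<in>prime_factors d. 1 - 1 / real p)"
      using fac by (intro mult_right_mono prod_le_1 prod_nonneg) (auto simp: in_prime_factors_iff)
    finally show ?thesis by (simp add: totient_formula2 mult_left_mono)
  qed
  have m_dvd: "m dvd N" if "m \<in> {1..M}" for m using that unfolding N_def by (intro dvd_fact) auto
  have div_dvd: "N div m dvd N" if "m \<in> {1..M}" for m
    using m_dvd[OF that] by (metis dvd_div_mult_self dvd_triv_left)
  have inj: "inj_on (\<lambda>m. N div m) {1..M}"
  proof (rule inj_onI)
    fix a b assume ab: "a \<in> {1..M}" "b \<in> {1..M}" "N div a = N div b"
    have "a * (N div a) = b * (N div b)" using m_dvd[OF ab(1)] m_dvd[OF ab(2)] by (metis dvd_mult_div_cancel)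
    moreover have "N div a > 0" using m_dvd[OF ab(1)] N by (metis dvd_div_mult_self gr0I mult_0 less_irrefl)
    ultimately show "a = b" using ab(3) by simp
  qed
  have "real N * (c * harm M) = (\<Sum>m\<in>{1..M}. real (N div m) * c)"
    using m_dvd by (simp add: harm_def sum_distrib_left real_of_nat_div field_simps)
  also have "\<dots> \<le> (\<Sum>m\<in>{1..M}. real (totient (N div m)))"
    by (intro sum_mono ge div_dvd)
  also have "\<dots> = (\<Sum>d\<in>(\<lambda>m. N div m) ` {1..M}. real (totient d))"
    using inj by (simp add: sum.reindex)
  also have "\<dots> \<le> (\<Sum>d | d dvd N. real (totient d))"
    using N div_dvd by (intro sum_mono2) auto
  also have "\<dots> = real N" using totient_divisor_sum[of N] by (simp flip: of_nat_sum)
  finally show ?thesis using N by (simp add: c_def)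
qed

lemma prod_primes_tendsto_0:
  "(\<lambda>M. \<Prod>p | prime p \<and> K \<le> p \<and> p \<le> M. 1 - 1 / real p) \<longlonglongrightarrow> 0"
proof (rule Lim_null_comparison)
  define c where "c = (\<Prod>p | prime p \<and> p < K. 1 - 1 / real p)"
  have fac: "0 < 1 - 1 / real p" if "prime p" for p
    using prime_gt_1_nat[OF that] by (simp add: divide_less_eq_1)
  have c: "c > 0" unfolding c_def using fac by (intro prod_pos) auto
  have "(\<lambda>M. 1 / c / harm M :: real) \<longlonglongrightarrow> 0"
    by (intro real_tendsto_divide_at_top[OF tendsto_const] harm_at_top)
  then show "(\<lambda>M. 1 / c / harm M :: real) \<longlonglongrightarrow> 0" .
  show "\<forall>\<^sub>F M in sequentially. norm (\<Prod>p | prime p \<and> K \<le> p \<and> p \<le> M. 1 - 1 / real p) \<le> 1 / c / harm M"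
    using eventually_ge_at_top[of "max K 1"]
  proof eventually_elim
    case (elim M)
    let ?Q = "\<Prod>p | prime p \<and> K \<le> p \<and> p \<le> M. 1 - 1 / real p"
    have Q: "?Q \<ge> 0" using fac by (intro prod_nonneg) (auto intro: less_imp_le)
    have "{p. prime p \<and> p \<le> M} = {p. prime p \<and> p < K} \<union> {p. prime p \<and> K \<le> p \<and> p \<le> M}" using elim by auto
    then have "(\<Prod>p | prime p \<and> p \<le> M. 1 - 1 / real p) = c * ?Q"
      unfolding c_def by (simp only:) (rule prod.union_disjoint, auto)
    then have "c * ?Q * harm M \<le> 1" using prod_primes_harm_le[of M] by simp
    moreover have "harm M > (0::real)" using elim by (simp add: harm_pos)
    ultimately have "?Q \<le> 1 / c / harm M" using c by (simp add: field_simps)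
    then show ?case using Q by simp
  qed
qed

section \<open>Control of the truncation errors\<close>

lemma prob_pmf_le:
  assumes "A \<inter> set_pmf q \<subseteq> B \<union> C"
  shows "measure_pmf.prob q A \<le> measure_pmf.prob q B + measure_pmf.prob q C"
proof -
  have "measure_pmf.prob q A = measure_pmf.prob q (A \<inter> set_pmf q)" by (simp add: measure_Int_set_pmf)
  also have "\<dots> \<le> measure_pmf.prob q (B \<union> C)" using assms by (intro measure_pmf.finite_measure_mono) auto
  also have "\<dots> \<le> measure_pmf.prob q B + measure_pmf.prob q C" by (rule measure_Un_le) auto
  finally show ?thesis .
qed

text \<open>Once \<open>M\<close> is at least the common multiple \<open>D\<close> of all the gcds involved, no truncation takes place at all.\<close>

lemma truncatable_outside:
  fixes \<Gamma> :: "(int ^ 'd) set"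
  assumes F: "Folner_sequence \<Gamma> F" and max: "maximal_of_rank k \<Gamma>" and x: "x \<notin> \<Gamma>"
  shows "uniformly_truncatable F x"
  unfolding uniformly_truncatable_def
proof (intro allI impI)
  fix K :: nat and e :: real assume e: "e > 0"
  obtain D where D: "D > 0" "\<And>y. y \<in> \<Gamma> \<Longrightarrow> vgcd (x + y) dvd D"
    using vgcd_translates_bounded[OF max x] by blast
  show "\<forall>\<^sub>F M in sequentially. \<forall>\<^sub>F n in sequentially. measure_pmf.prob (pmf_of_set (F n))
       {y. \<not> enat_near K (gcd_inf (x + y)) (enat (truncated_gcd M (x + y)))} < e"
    using eventually_ge_at_top[of D]
  proof eventually_elim
    case (elim M)
    have near: "enat_near K (gcd_inf (x + y)) (enat (truncated_gcd M (x + y)))" if "y \<in> \<Gamma>" for y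
    proof -
      have "vgcd (x + y) > 0" "vgcd (x + y) \<le> D" using D(2)[OF that] D(1) by (auto intro: dvd_imp_le dvd_pos_nat)
      then have "truncated_gcd M (x + y) = vgcd (x + y)"
        unfolding truncated_gcd_def using elim by (intro truncated_product_dvd_eq) auto
      then show ?thesis by (simp add: gcd_inf_def enat_near_def)
    qed
    have "set_pmf (pmf_of_set (F n)) \<subseteq> \<Gamma>" for n
      using F by (subst set_pmf_of_set) (auto simp: Folner_sequence_def)
    then have "{y. \<not> enat_near K (gcd_inf (x + y)) (enat (truncated_gcd M (x + y)))} \<inter> set_pmf (pmf_of_set (F n)) \<subseteq> {} \<union> {}" for n
      using near by blast
    from prob_pmf_le[OF this]
    have "measure_pmf.prob (pmf_of_set (F n))
       {y. \<not> enat_near K (gcd_inf (x + y)) (enat (truncated_gcd M (x + y)))} \<le> 0" for n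
      by simp
    then show ?case using e by (intro always_eventually allI) (rule le_less_trans)
  qed
qed

text \<open>
  For \<open>M \<ge> b\<close> the truncation can only be wrong if \<open>vgcd (x + y) > b\<close> or \<open>x + y = 0\<close>. The former event has almost the
  same probability as \<open>vgcd y > b\<close>, which tightness bounds, and the latter is the single point \<open>- x\<close>.
\<close>

lemma truncatable_tight:
  fixes \<Gamma> :: "(int ^ 'd) set"
  assumes F: "Folner_sequence \<Gamma> F" and \<Gamma>: "add_subgroup \<Gamma>" and g: "g \<in> \<Gamma>" "g \<noteq> 0"
    and tight: "tight (\<lambda>n. distr (measure_pmf (pmf_of_set (F n))) borel (\<lambda>y. real (vgcd y)))"
    and x: "x \<in> \<Gamma>"
  shows "uniformly_truncatable F x"
  unfolding uniformly_truncatable_def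
proof (intro allI impI)
  fix K :: nat and e :: real assume e: "e > 0"
  obtain a b :: real where ab: "\<And>n. measure (distr (measure_pmf (pmf_of_set (F n))) borel (\<lambda>y. real (vgcd y))) {a<..b} > 1 - e / 4"
    using tight e unfolding tight_def by (meson divide_pos_pos zero_less_numeral)
  have tail: "measure_pmf.prob (pmf_of_set (F n)) {y. real (vgcd y) > b} < e / 4" for n
  proof -
    have "1 - e / 4 < measure_pmf.prob (pmf_of_set (F n)) {y. real (vgcd y) \<in> {a<..b}}"
      using ab[of n] by (simp add: measure_distr vimage_def)
    also have "\<dots> \<le> measure_pmf.prob (pmf_of_set (F n)) (UNIV - {y. real (vgcd y) > b})"
      by (intro measure_pmf.finite_measure_mono) auto
    also have "\<dots> = 1 - measure_pmf.prob (pmf_of_set (F n)) {y. real (vgcd y) > b}"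
      using measure_pmf.prob_compl[of "{y. real (vgcd y) > b}" "pmf_of_set (F n)"] by simp
    finally show ?thesis by linarith
  qed
  show "\<forall>\<^sub>F M in sequentially. \<forall>\<^sub>F n in sequentially. measure_pmf.prob (pmf_of_set (F n))
       {y. \<not> enat_near K (gcd_inf (x + y)) (enat (truncated_gcd M (x + y)))} < e"
    using eventually_ge_at_top[of "nat \<lceil>b\<rceil>"]
  proof eventually_elim
    case (elim M)
    have "\<forall>\<^sub>F n in sequentially. dist (measure_pmf.prob (pmf_of_set (F n)) {y. real (vgcd (y + x)) > b}
        - measure_pmf.prob (pmf_of_set (F n)) {y. real (vgcd y) > b}) 0 < e / 4"
      using Folner_shift[OF F x, of "\<lambda>y. real (vgcd y) > b"] e by (intro tendstoD) auto
    moreover have "\<forall>\<^sub>F n in sequentially. dist (measure_pmf.prob (pmf_of_set (F n)) {- x}) 0 < e / 4"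
      using Folner_point_null[OF F \<Gamma> g, of "- x"] e by (intro tendstoD) auto
    ultimately show ?case
    proof eventually_elim
      case (elim n)
      have "measure_pmf.prob (pmf_of_set (F n)) {y. \<not> enat_near K (gcd_inf (x + y)) (enat (truncated_gcd M (x + y)))}
          \<le> measure_pmf.prob (pmf_of_set (F n)) {y. real (vgcd (y + x)) > b} + measure_pmf.prob (pmf_of_set (F n)) {- x}"
      proof (rule prob_pmf_le, rule subsetI, rule ccontr)
        fix y assume y: "y \<in> {y. \<not> enat_near K (gcd_inf (x + y)) (enat (truncated_gcd M (x + y)))} \<inter> set_pmf (pmf_of_set (F n))"
          "y \<notin> {y. real (vgcd (y + x)) > b} \<union> {- x}"
        have "x + y \<noteq> 0" using y(2) by (auto simp: add_eq_0_iff)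
        then have "vgcd (x + y) \<ge> 1" using vgcd_eq_0_iff[of "x + y"] by linarith
        moreover have "vgcd (x + y) \<le> M"
          using y(2) \<open>nat \<lceil>b\<rceil> \<le> M\<close> by (simp add: add.commute)
        ultimately have "truncated_gcd M (x + y) = vgcd (x + y)"
          unfolding truncated_gcd_def by (intro truncated_product_dvd_eq) auto
        then show False using y(1) by (simp add: gcd_inf_def enat_near_def)
      qed
      then show ?case using elim tail[of n] unfolding dist_real_def by linarith
    qed
  qed
qed

text \<open>
  If a prime \<open>p\<close> with \<open>K \<le> p \<le> M\<close> divides a nonzero \<open>x + y\<close>, then the gcd and its truncation are both at least
  \<open>K\<close>. The probability that no such prime divides \<open>x + y\<close> tends to a product of factors at most
  \<open>1 - 1 / p\<close>, since a cyclic group has at most \<open>p\<close> classes modulo \<open>p\<close>.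
\<close>

lemma truncatable_rank_one:
  fixes \<Gamma> :: "(int ^ 'd) set"
  assumes F: "Folner_sequence \<Gamma> F" and max: "maximal_of_rank 1 \<Gamma>" and g: "g \<in> \<Gamma>" "g \<noteq> 0"
    and x: "x \<in> \<Gamma>"
  shows "uniformly_truncatable F x"
  unfolding uniformly_truncatable_def
proof (intro allI impI)
  fix K :: nat and e :: real assume e: "e > 0"
  have \<Gamma>: "add_subgroup \<Gamma>" using max by (simp add: maximal_of_rank_def)
  obtain h where h: "\<Gamma> = range (\<lambda>a. a *s h)" using maximal_rank_one_cyclic[OF max] by blast
  have "\<forall>\<^sub>F M in sequentially. (\<Prod>p | prime p \<and> K \<le> p \<and> p \<le> M. 1 - 1 / real p) < e / 2"
    using prod_primes_tendsto_0[of K] e by (intro order_tendstoD(2)) auto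
  then show "\<forall>\<^sub>F M in sequentially. \<forall>\<^sub>F n in sequentially. measure_pmf.prob (pmf_of_set (F n))
       {y. \<not> enat_near K (gcd_inf (x + y)) (enat (truncated_gcd M (x + y)))} < e"
  proof eventually_elim
    case (elim M)
    define P where "P = {p. prime p \<and> K \<le> p \<and> p \<le> M}"
    have P: "finite P" "\<And>p. p \<in> P \<Longrightarrow> prime p" unfolding P_def by auto
    let ?none = "{y. \<forall>p\<in>P. \<not> p dvd vgcd (x + y)}"
    let ?E = "{W \<in> space (chains_law \<Gamma>). \<forall>p\<in>P. x \<notin> W p 1}"
    have E_sets: "?E \<in> sets (chains_law \<Gamma>)"
      using P by (intro predE pred_intros_finite pred_chains_component) auto
    have "(\<lambda>n. measure_pmf.expectation (pmf_of_set (F n)) (\<lambda>y. indicator ?none y :: real))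
        \<longlonglongrightarrow> (\<integral>W. (if \<forall>p\<in>P. x \<notin> W p 1 then 1 else 0 :: real) \<partial>chains_law \<Gamma>)"
    proof (rule finite_level_limit[OF F \<Gamma> P, where e = "\<lambda>_. 1"])
      show "(\<lambda>W. if \<forall>p\<in>P. x \<notin> W p 1 then 1 else 0 :: real) \<in> borel_measurable (chains_law \<Gamma>)"
        by (rule measurable_If[OF _ _ E_sets]) auto
    next
      fix W :: "nat \<Rightarrow> nat \<Rightarrow> (int ^ 'd) set" and y :: "int ^ 'd"
      assume "\<And>p. p \<in> P \<Longrightarrow> W p 1 = neg_class (p ^ 1) y"
      then show "(if \<forall>p\<in>P. x \<notin> W p 1 then 1 else 0 :: real) = indicator ?none y"
        by (auto simp: neg_class_def)
    next
      fix y y' :: "int ^ 'd"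
      assume "\<And>p. p \<in> P \<Longrightarrow> p ^ 1 dvd vgcd (y - y')"
      then have "neg_class p y = neg_class p y'" if "p \<in> P" for p using that by (simp add: neg_class_eq_iff)
      then have "x \<in> neg_class p y \<longleftrightarrow> x \<in> neg_class p y'" if "p \<in> P" for p using that by simp
      then show "indicator ?none y = (indicator ?none y' :: real)" by (simp add: neg_class_def indicator_def)
    qed
    also have "(\<integral>W. (if \<forall>p\<in>P. x \<notin> W p 1 then 1 else 0 :: real) \<partial>chains_law \<Gamma>) = measure (chains_law \<Gamma>) ?E"
    proof -
      have "(\<integral>W. (if \<forall>p\<in>P. x \<notin> W p 1 then 1 else 0 :: real) \<partial>chains_law \<Gamma>) = (\<integral>W. indicator ?E W \<partial>chains_law \<Gamma>)"
        by (intro Bochner_Integration.integral_cong) (auto simp: indicator_def)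
      also have "\<dots> = measure (chains_law \<Gamma>) ?E" using E_sets by simp
      finally show ?thesis .
    qed
    also have "\<dots> = (\<Prod>p\<in>P. measure (coset_chain_law \<Gamma> p) {w. x \<notin> w 1})"
      using P by (rule measure_chains_cylinder)
    finally have lim: "(\<lambda>n. measure_pmf.prob (pmf_of_set (F n)) ?none)
        \<longlonglongrightarrow> (\<Prod>p\<in>P. measure (coset_chain_law \<Gamma> p) {w. x \<notin> w 1})"
      by simp
    have "measure (coset_chain_law \<Gamma> p) {w. x \<notin> w 1} \<le> 1 - 1 / real p" if p: "p \<in> P" for p
    proof -
      interpret L: prob_space "coset_chain_law \<Gamma> p" by (rule prob_space_coset_chain_law)
      have p0: "p > 0" using P(2)[OF p] prime_gt_0_nat by simp
      have "measure (coset_chain_law \<Gamma> p) {w. x \<notin> w 1} = 1 - measure (coset_chain_law \<Gamma> p) {w. x \<in> w 1}"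
        using L.prob_compl[OF sets_chain_Collect[OF pred_chain_component[where n = 1 and Q = "\<lambda>A. x \<in> A"]]]
        by (simp add: Compl_eq_Diff_UNIV[symmetric] Collect_neg_eq)
      also have "measure (coset_chain_law \<Gamma> p) {w. x \<in> w 1} = 1 / card (neg_class (p ^ 1) ` \<Gamma>)"
        by (rule chain_mem_prob(2)[OF \<Gamma> p0 x])
      also have "1 - 1 / real (card (neg_class (p ^ 1) ` \<Gamma>)) \<le> 1 - 1 / real p"
      proof -
        have "card (neg_class p ` \<Gamma>) \<le> p" unfolding h using p0 by (rule card_neg_class_cyclic_le)
        moreover have "card (neg_class p ` \<Gamma>) > 0"
          using finite_neg_class_image[OF p0] x by (auto simp: card_gt_0_iff)
        ultimately show ?thesis by (simp add: frac_le)
      qed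
      finally show ?thesis .
    qed
    then have "(\<Prod>p\<in>P. measure (coset_chain_law \<Gamma> p) {w. x \<notin> w 1}) \<le> (\<Prod>p\<in>P. 1 - 1 / real p)"
      by (intro prod_mono) auto
    then have "(\<Prod>p\<in>P. measure (coset_chain_law \<Gamma> p) {w. x \<notin> w 1}) < e / 2"
      using elim by (simp add: P_def)
    then have "\<forall>\<^sub>F n in sequentially. measure_pmf.prob (pmf_of_set (F n)) ?none < e / 2"
      by (rule order_tendstoD(2)[OF lim])
    moreover have "\<forall>\<^sub>F n in sequentially. measure_pmf.prob (pmf_of_set (F n)) {- x} < e / 2"
      using Folner_point_null[OF F \<Gamma> g, of "- x"] e by (intro order_tendstoD(2)) auto
    ultimately show ?case
    proof eventually_elim
      case (elim n)
      have "measure_pmf.prob (pmf_of_set (F n)) {y. \<not> enat_near K (gcd_inf (x + y)) (enat (truncated_gcd M (x + y)))}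
          \<le> measure_pmf.prob (pmf_of_set (F n)) ?none + measure_pmf.prob (pmf_of_set (F n)) {- x}"
      proof (rule prob_pmf_le, rule subsetI, rule ccontr)
        fix y assume y: "y \<in> {y. \<not> enat_near K (gcd_inf (x + y)) (enat (truncated_gcd M (x + y)))} \<inter> set_pmf (pmf_of_set (F n))"
          "y \<notin> ?none \<union> {- x}"
        then obtain p where p: "prime p" "K \<le> p" "p \<le> M" "p dvd vgcd (x + y)" by (auto simp: P_def)
        have "x + y \<noteq> 0" using y(2) by (auto simp: add_eq_0_iff)
        then have "vgcd (x + y) > 0" using vgcd_eq_0_iff[of "x + y"] by linarith
        then have "K \<le> vgcd (x + y)" using p by (meson dvd_imp_le order_trans)
        moreover have "K \<le> truncated_gcd M (x + y)"
          unfolding truncated_gcd_def using p truncated_product_ge_prime[of p M "\<lambda>p n. p ^ n dvd vgcd (x + y)"] by simp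
        ultimately show False using y(1) by (simp add: gcd_inf_def enat_near_iff)
      qed
      then show ?case using elim by linarith
    qed
  qed
qed

theorem proposition3p1:
  fixes \<Gamma> :: "(int ^ 'd) set" and F :: "nat \<Rightarrow> (int ^ 'd) set" and k :: nat
  assumes "k \<ge> 1"
    and "maximal_of_rank k \<Gamma>"
    and "Folner_sequence \<Gamma> F"
  shows "converges_on (UNIV - \<Gamma>) (\<lambda>n. shift_law (F n) gcd_inf) (limit_law \<Gamma>) \<and>
    (k = 1 \<or> tight (\<lambda>n. distr (measure_pmf (pmf_of_set (F n))) borel (\<lambda>y. real (vgcd y))) \<longrightarrow>
      weakly_converges euclidean (\<lambda>n. shift_law (F n) gcd_inf) (limit_law \<Gamma>))"
proof -
  have \<Gamma>: "add_subgroup \<Gamma>" "zrank \<Gamma> \<ge> 1" using assms(1,2) by (auto simp: maximal_of_rank_def)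
  obtain g where g: "g \<in> \<Gamma>" "g \<noteq> 0" using zrank_pos_nonzero[OF \<Gamma>(2)] by blast
  have limit: "limit_law \<Gamma> = distr (chains_law \<Gamma>) borel limit_config"
    by (simp add: limit_law_def limit_config_def[abs_def])
  have "converges_on (UNIV - \<Gamma>) (\<lambda>n. shift_law (F n) gcd_inf) (limit_law \<Gamma>)"
    unfolding converges_on_def weakly_converges_def
  proof (intro allI impI)
    fix f :: "(int ^ 'd \<Rightarrow> enat) \<Rightarrow> real"
    let ?T = "product_topology (\<lambda>_. euclidean :: enat topology) (UNIV - \<Gamma>)"
    assume "continuous_map ?T euclideanreal f \<and> bounded (f ` topspace ?T)"
    then have f: "continuous_map ?T euclideanreal f" "bounded (f ` extensional (UNIV - \<Gamma>))"
      by (simp_all add: PiE_def)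
    show "(\<lambda>n. \<integral>\<omega>. f \<omega> \<partial>pushforward_on (UNIV - \<Gamma>) (shift_law (F n) gcd_inf))
        \<longlonglongrightarrow> (\<integral>\<omega>. f \<omega> \<partial>pushforward_on (UNIV - \<Gamma>) (limit_law \<Gamma>))"
      unfolding limit shift_law_def integral_pushforward_on[OF measurable_limit_config f(1)]
      by (subst integral_pushforward_on[OF _ f(1)], simp)
        (rule convergence_criterion[OF assms(3) \<Gamma>(1) g f truncatable_outside[OF assms(3,2)]], simp)
  qed
  moreover have "weakly_converges euclidean (\<lambda>n. shift_law (F n) gcd_inf) (limit_law \<Gamma>)"
    if *: "k = 1 \<or> tight (\<lambda>n. distr (measure_pmf (pmf_of_set (F n))) borel (\<lambda>y. real (vgcd y)))"
    unfolding weakly_converges_def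
  proof (intro allI impI)
    fix f :: "(int ^ 'd \<Rightarrow> enat) \<Rightarrow> real"
    assume f: "continuous_map euclidean euclideanreal f \<and> bounded (f ` topspace euclidean)"
    have fm: "f \<in> borel_measurable borel"
      using f by (intro borel_measurable_continuous_onI) (simp add: continuous_map_iff_continuous2)
    have trunc: "uniformly_truncatable F x" for x
    proof (cases "x \<in> \<Gamma>")
      case True
      then show ?thesis
        using * truncatable_tight[OF assms(3) \<Gamma>(1) g _ True] truncatable_rank_one[OF assms(3) _ g True] assms(2) by blast
    qed (rule truncatable_outside[OF assms(3,2)])
    have "(\<lambda>n. measure_pmf.expectation (pmf_of_set (F n)) (\<lambda>y. f (restrict (\<lambda>x. gcd_inf (x + y)) UNIV)))
        \<longlonglongrightarrow> (\<integral>W. f (restrict (limit_config W) UNIV) \<partial>chains_law \<Gamma>)"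
      using f trunc by (intro convergence_criterion[OF assms(3) \<Gamma>(1) g]) (simp_all add: euclidean_product_topology)
    moreover have "(\<integral>\<omega>. f \<omega> \<partial>shift_law (F n) gcd_inf) = measure_pmf.expectation (pmf_of_set (F n)) (\<lambda>y. f (\<lambda>x. gcd_inf (x + y)))" for n
      unfolding shift_law_def by (rule integral_distr[OF _ fm]) simp
    moreover have "(\<integral>\<omega>. f \<omega> \<partial>limit_law \<Gamma>) = (\<integral>W. f (limit_config W) \<partial>chains_law \<Gamma>)"
      unfolding limit by (rule integral_distr[OF measurable_limit_config fm])
    moreover have "restrict \<omega> UNIV = \<omega>" for \<omega> :: "int ^ 'd \<Rightarrow> enat" by (simp add: restrict_def)
    ultimately show "(\<lambda>n. \<integral>\<omega>. f \<omega> \<partial>shift_law (F n) gcd_inf) \<longlonglongrightarrow> (\<integral>\<omega>. f \<omega> \<partial>limit_law \<Gamma>)"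
      by (simp only:)
  qed
  ultimately show ?thesis by blast
qed

end
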